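(* Let $K$ be an infinite field, let $P=K[x_1,\dots,x_n]$, let $I$ be a strongly stable monomial ideal in $P$, and let $\mathcal{L}$ be a distraction matrix with entries in $P_1$. Then $$\mathrm{gin}_{\mathrm{drl}}\big(D_{\mathcal{L}}(I)\big)=I .$$
   Context: $P=K[x_1,\dots,x_n]$ is standard graded and $P_d$ is its degree-$d$ component. A distraction matrix is an infinite matrix $\mathcal{L}=(L_{ij}\mid i=1,\dots,n,\ j\ge 1)$ with $L_{ij}\in P_1$ such that (a) $\langle L_{1j_1},\dots,L_{nj_n}\rangle=P_1$ ($K$-linear span) for all $j_1,\dots,j_n\ge 1$; (b) there is $N$ with $L_{ij}=L_{iN}$ for all $i$ and all $j>N$. For $t=x_1^{\alpha_1}\cdots x_n^{\alpha_n}$ put $D_{\mathcal{L}}(t)=\prod_{i=1}^n\prod_{j=1}^{\alpha_i}L_{ij}$ and extend $D_{\mathcal{L}}$ to $P$ by $K$-linearity; $D_{\mathcal{L}}(V)$ denotes the image of a subspace $V$. For a monomial ideal $I$, $D_{\mathcal{L}}(I)$ is a homogeneous ideal. A monomial ideal $I$ is strongly stable if for every power product $t\in I$, every $j$ with $x_j\mid t$ and every $i\le j$, one has $x_i\,t/x_j\in I$. $\mathrm{in}_{\mathrm{drl}}$ denotes the initial ideal with respect to DegRevLex with $x_1>\dots>x_n$. A matrix $g=(g_{ij})\in GL(n,K)$ acts on $P$ by $K$-algebra automorphisms via $g(x_j)=\sum_i g_{ij}x_i$. For a homogeneous ideal $J$, the generic initial ideal $\mathrm{gin}_{\mathrm{drl}}(J)$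 is the monomial ideal equal to $\mathrm{in}_{\mathrm{drl}}(g(J))$ for all $g$ in a suitable nonempty Zariski-open subset of $GL(n,K)$ (it is a known theorem of Galligo and Bayer–Stillman that it is well defined). *)

theory Defs
  imports "HOL-Library.Poly_Mapping" "HOL-Algebra.Ideal" "Jordan_Normal_Form.Matrix"
begin

text \<open>
  All indices are zero-based: the indeterminates \<open>x_1, \<dots>, x_n\<close> are \<open>X 0, \<dots>, X (n - 1)\<close>, and
  \<open>L i j\<close> is the entry \<open>L_{i+1,j+1}\<close> of a distraction matrix.  Power products are
  \<open>nat \<Rightarrow>\<^sub>0 nat\<close> (exponent maps) and the ring \<open>K[x_1, \<dots>, x_n]\<close> is the subring \<open>poly_ring n\<close> of
  the polynomials in countably many indeterminates.
\<close>

type_synonym pp = "nat \<Rightarrow>\<^sub>0 nat"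
type_synonym ('v, 'k) mpoly = "('v \<Rightarrow>\<^sub>0 nat) \<Rightarrow>\<^sub>0 'k"

definition pconst :: "'k::zero \<Rightarrow> ('v, 'k) mpoly" where
  "pconst c = Poly_Mapping.single 0 c"

definition pmonom :: "('v \<Rightarrow>\<^sub>0 nat) \<Rightarrow> ('v, 'k::zero_neq_one) mpoly" where
  "pmonom t = Poly_Mapping.single t 1"

definition X :: "'v \<Rightarrow> ('v, 'k::zero_neq_one) mpoly" where
  "X v = pmonom (Poly_Mapping.single v 1)"

definition mpolys_in :: "'v set \<Rightarrow> ('v, 'k::zero) mpoly set" where
  "mpolys_in V = {p. \<forall>t\<in>Poly_Mapping.keys p. Poly_Mapping.keys t \<subseteq> V}"

text \<open>
  Substitution of \<open>x v\<close> for the indeterminate \<open>v\<close>, with coefficients mapped by \<open>h\<close>.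
\<close>

definition psubst ::
  "('k::zero \<Rightarrow> 'r::comm_semiring_1) \<Rightarrow> ('v \<Rightarrow> 'r) \<Rightarrow> ('v, 'k) mpoly \<Rightarrow> 'r" where
  "psubst h x p = (\<Sum>t\<in>Poly_Mapping.keys p. h (Poly_Mapping.lookup p t) *
     (\<Prod>v\<in>Poly_Mapping.keys t. x v ^ Poly_Mapping.lookup t v))"

definition pps :: "nat \<Rightarrow> pp set" where
  "pps n = {t. Poly_Mapping.keys t \<subseteq> {..<n}}"

definition pdeg :: "pp \<Rightarrow> nat" where
  "pdeg t = (\<Sum>i\<in>Poly_Mapping.keys t. Poly_Mapping.lookup t i)"

definition poly_ring :: "nat \<Rightarrow> (nat, 'k::comm_ring_1) mpoly ring" where
  "poly_ring n = \<lparr>carrier = mpolys_in {..<n}, monoid.mult = (*), one = 1, zero = 0, add = (+)\<rparr>"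

definition hom_comp :: "nat \<Rightarrow> nat \<Rightarrow> (nat, 'k::zero) mpoly set" where
  "hom_comp n d = {p \<in> mpolys_in {..<n}. \<forall>t\<in>Poly_Mapping.keys p. pdeg t = d}"

definition monomial_ideal :: "nat \<Rightarrow> (nat, 'k::comm_ring_1) mpoly set \<Rightarrow> bool" where
  "monomial_ideal n I \<longleftrightarrow> (\<exists>S\<subseteq>pps n. I = genideal (poly_ring n) (pmonom ` S))"

definition strongly_stable :: "nat \<Rightarrow> (nat, 'k::comm_ring_1) mpoly set \<Rightarrow> bool" where
  "strongly_stable n I \<longleftrightarrow> monomial_ideal n I \<and>
     (\<forall>t\<in>pps n. pmonom t \<in> I \<longrightarrow>
       (\<forall>j\<in>Poly_Mapping.keys t. \<forall>i\<le>j.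
          pmonom (Poly_Mapping.single i 1 + t - Poly_Mapping.single j 1) \<in> I))"

definition distraction_matrix :: "nat \<Rightarrow> (nat \<Rightarrow> nat \<Rightarrow> (nat, 'k::field) mpoly) \<Rightarrow> bool" where
  "distraction_matrix n L \<longleftrightarrow>
     (\<forall>i<n. \<forall>j. L i j \<in> hom_comp n 1) \<and>
     (\<forall>js :: nat \<Rightarrow> nat.
        module.span (\<lambda>c p. pconst c * p) {L i (js i) | i. i < n} = hom_comp n 1) \<and>
     (\<exists>N. \<forall>i<n. \<forall>j>N. L i j = L i N)"

definition distraction_pp ::
  "nat \<Rightarrow> (nat \<Rightarrow> nat \<Rightarrow> (nat, 'k::field) mpoly) \<Rightarrow> pp \<Rightarrow> (nat, 'k) mpoly" where
  "distraction_pp n L t = (\<Prod>i<n. \<Prod>j<Poly_Mapping.lookup t i. L i j)"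

definition distraction ::
  "nat \<Rightarrow> (nat \<Rightarrow> nat \<Rightarrow> (nat, 'k::field) mpoly) \<Rightarrow> (nat, 'k) mpoly \<Rightarrow> (nat, 'k) mpoly" where
  "distraction n L p =
     (\<Sum>t\<in>Poly_Mapping.keys p. pconst (Poly_Mapping.lookup p t) * distraction_pp n L t)"

text \<open>
  DegRevLex with \<open>X 0 > X 1 > \<dots>\<close>: among power products of equal degree, \<open>s < t\<close> iff \<open>s\<close> has the
  larger exponent at the last index where they differ.
\<close>

definition drl_less :: "pp \<Rightarrow> pp \<Rightarrow> bool" where
  "drl_less s t \<longleftrightarrow> pdeg s < pdeg t \<or>
     pdeg s = pdeg t \<and>
       (\<exists>i. Poly_Mapping.lookup s i > Poly_Mapping.lookup t i \<and>
            (\<forall>j>i. Poly_Mapping.lookup s j = Poly_Mapping.lookup t j))"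

definition lpp_drl :: "(nat, 'k::zero) mpoly \<Rightarrow> pp" where
  "lpp_drl p = (THE t. t \<in> Poly_Mapping.keys p \<and>
     (\<forall>s\<in>Poly_Mapping.keys p. s \<noteq> t \<longrightarrow> drl_less s t))"

definition in_drl :: "nat \<Rightarrow> (nat, 'k::comm_ring_1) mpoly set \<Rightarrow> (nat, 'k) mpoly set" where
  "in_drl n J = genideal (poly_ring n) {pmonom (lpp_drl p) | p. p \<in> J \<and> p \<noteq> 0}"

definition GL :: "nat \<Rightarrow> 'k::field mat set" where
  "GL n = {g \<in> carrier_mat n n. invertible_mat g}"

definition gl_act :: "nat \<Rightarrow> 'k::field mat \<Rightarrow> (nat, 'k) mpoly \<Rightarrow> (nat, 'k) mpoly" where
  "gl_act n g = psubst pconst (\<lambda>j. \<Sum>i<n. pconst (g $$ (i, j)) * X i)"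

text \<open>
  Zariski-open subsets of \<open>GL(n,K)\<close> are the complements in \<open>GL(n,K)\<close> of common zero sets of
  polynomials in the \<open>n\<^sup>2\<close> matrix entries; allowing \<open>1 / det\<close> as well gives the same topology.
\<close>

definition zariski_open_GL :: "nat \<Rightarrow> 'k::field mat set \<Rightarrow> bool" where
  "zariski_open_GL n U \<longleftrightarrow>
     (\<exists>F\<subseteq>(mpolys_in ({..<n} \<times> {..<n}) :: (nat \<times> nat, 'k) mpoly set).
        U = {g \<in> GL n. \<exists>f\<in>F. psubst (\<lambda>c. c) (\<lambda>ij. g $$ ij) f \<noteq> 0})"

text \<open>
  Over an infinite field two nonempty Zariski-open subsets of \<open>GL(n,K)\<close> meet, so there is at most
  one such \<open>M\<close>; for homogeneous ideals it exists by the theorem of Galligo and Bayer--Stillman.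
\<close>

definition gin_drl :: "nat \<Rightarrow> (nat, 'k::field) mpoly set \<Rightarrow> (nat, 'k) mpoly set" where
  "gin_drl n J = (THE M. monomial_ideal n M \<and>
     (\<exists>U. zariski_open_GL n U \<and> U \<noteq> {} \<and> (\<forall>g\<in>U. in_drl n (gl_act n g ` J) = M)))"

end

theory Submission
  imports Defs "Jordan_Normal_Form.Determinant"
begin

text \<open>
  Since \<open>g\<close> acts by ring homomorphisms, \<open>g \<circ> D_L = D_A\<close> for the matrix \<open>A\<close> of the forms
  \<open>g(L_{ij})\<close>.  For \<open>g\<close> outside finitely many hypersurfaces, the forms \<open>A_{i j_i}\<close> with \<open>i \<le> m\<close>
  span \<open>x_m\<close> modulo \<open>x_{m+1}, \<dots>, x_n\<close>, for all \<open>m\<close> and all choices of columns \<open>j_i\<close>.  Given this,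
  every power product \<open>t \<in> I\<close> is the leading power product of some \<open>D_A(f)\<close> with \<open>f \<in> I\<close>, by induction
  on the degree: write \<open>t = x_m t'\<close> with \<open>m\<close> the last index occurring in \<open>t\<close> and let \<open>D_A(f')\<close> have
  leading power product \<open>t'\<close>, where \<open>f' \<in> I : x_m\<close>.  For each power product \<open>s\<close> of \<open>f'\<close> write
  \<open>x_m\<close> as \<open>\<Sum>\<^sub>i\<^sub>\<le>\<^sub>m c_i A_{i, s_i + 1}\<close> modulo \<open>x_{m+1}, \<dots>, x_n\<close>; then \<open>x_m D_A(s)\<close> becomes
  \<open>\<Sum>\<^sub>i\<^sub>\<le>\<^sub>m c_i D_A(x_i s)\<close>, and \<open>x_i s \<in> I\<close> by strong stability.  The discarded terms involve an
  indeterminate after \<open>x_m\<close>, so in DegRevLex they lie below \<open>t\<close>.  Hence \<open>I \<subseteq> in(D_A(I))\<close>, and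
  equality follows by comparing dimensions in bounded degree.
\<close>

abbreviation lookup where "lookup \<equiv> Poly_Mapping.lookup"
abbreviation keys where "keys \<equiv> Poly_Mapping.keys"
abbreviation single where "single \<equiv> Poly_Mapping.single"

subsection \<open>Polynomials as polynomial mappings\<close>

lemma poly_mapping_sum_single: "p = (\<Sum>t\<in>keys p. single t (lookup p t))"
  by (rule poly_mapping_eqI)
    (auto simp: lookup_sum lookup_single when_def in_keys_iff sum.delta)

text \<open>Reduces identities that are additive in a polynomial to single terms. The zero
  polynomial is covered as \<open>single t 0\<close>.\<close>

lemma poly_mapping_single_induct [case_names single add]:
  fixes p :: "'a \<Rightarrow>\<^sub>0 'b::comm_monoid_add"
  assumes "\<And>t c. P (single t c)" and "\<And>p q. P p \<Longrightarrow> P q \<Longrightarrow> P (p + q)"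
  shows "P p"
proof -
  have "P (\<Sum>t\<in>A. single t (lookup p t))" if "finite A" for A
    using that
  proof (induction A rule: finite_induct)
    case empty
    show ?case using assms(1)[of _ 0] by simp
  next
    case (insert x F)
    then show ?case using assms by simp
  qed
  then show ?thesis
    by (metis poly_mapping_sum_single finite_keys)
qed

lemma keys_sum_subset: "keys (sum f A) \<subseteq> (\<Union>i\<in>A. keys (f i))"
proof (induction A rule: infinite_finite_induct)
  case (insert x F)
  then show ?case using keys_add[of "f x" "sum f F"] by auto
qed auto

lemma in_keys_sumD: "t \<in> keys (sum f A) \<Longrightarrow> \<exists>i\<in>A. t \<in> keys (f i)"
  using subsetD[OF keys_sum_subset[of f A], of t] by simp

lemma keys_diff_subset:
  fixes p q :: "'a \<Rightarrow>\<^sub>0 'b::ab_group_add"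
  shows "keys (p - q) \<subseteq> keys p \<union> keys q"
  by (auto simp: in_keys_iff lookup_minus)

lemma keys_uminus: "keys (- p) = keys p"
  for p :: "'a \<Rightarrow>\<^sub>0 'b::ab_group_add"
  by (simp add: set_eq_iff in_keys_iff)

lemma keys_pp_add: "keys (s + t :: 'v \<Rightarrow>\<^sub>0 nat) = keys s \<union> keys t"
  by (auto simp: in_keys_iff lookup_add)

lemma lookup_single_mult:
  fixes s t :: "'a::cancel_comm_monoid_add" and c :: "'b::comm_semiring_1"
  shows "lookup (single s c * p) (s + t) = c * lookup p t"
  by (induction p rule: poly_mapping_single_induct)
    (auto simp: mult_single lookup_single distrib_left lookup_add when_def)

lemma keys_single_mult:
  fixes s :: "'a::cancel_comm_monoid_add" and c :: "'b::comm_semiring_1"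
  shows "keys (single s c * p) \<subseteq> (+) s ` keys p"
proof -
  have "keys (single s c) \<subseteq> {s}" by simp
  then show ?thesis using keys_mult[of "single s c" p] by (auto split: if_splits)
qed

lemma lookup_pconst_mult: "lookup (pconst c * p) t = c * lookup p t"
  for p :: "('v, 'k::comm_semiring_1) mpoly"
  using lookup_single_mult[of 0 c p t] by (simp add: pconst_def)

lemma pconst_comm_ring_hom: "comm_ring_hom (pconst :: 'k::comm_ring_1 \<Rightarrow> ('v, 'k) mpoly)"
  by unfold_locales (auto simp: pconst_def single_add mult_single)

lemma keys_pconst_mult: "keys (pconst c * p) \<subseteq> keys p"
  for p :: "('v, 'k::comm_semiring_1) mpoly"
  by (auto simp: in_keys_iff lookup_pconst_mult)

lemma keys_pmonom [simp]: "keys (pmonom t :: ('v, 'k::zero_neq_one) mpoly) = {t}"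
  by (simp add: pmonom_def)

lemma single_1_eq_iff: "single i (1::nat) = single j 1 \<longleftrightarrow> i = j"
proof
  assume "single i (1::nat) = single j 1"
  then have "keys (single i (1::nat)) = keys (single j (1::nat))" by (rule arg_cong)
  then show "i = j" by simp
qed simp

lemma lookup_X_single: "lookup (X i) (single j 1) = (if i = j then 1 else 0)"
  unfolding X_def pmonom_def lookup_single single_1_eq_iff by (simp add: when_def)

lemma mpolys_in_0: "0 \<in> mpolys_in V"
  by (simp add: mpolys_in_def)

lemma mpolys_in_pconst: "pconst c \<in> mpolys_in V"
  by (auto simp: mpolys_in_def pconst_def)

lemma mpolys_in_1: "1 \<in> mpolys_in V"
  by (auto simp: mpolys_in_def)

lemma mpolys_in_X: "v \<in> V \<Longrightarrow> X v \<in> mpolys_in V"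
  by (auto simp: mpolys_in_def X_def)

lemma mpolys_in_add: "p \<in> mpolys_in V \<Longrightarrow> q \<in> mpolys_in V \<Longrightarrow> p + q \<in> mpolys_in V"
  using keys_add[of p q] by (fastforce simp: mpolys_in_def)

lemma mpolys_in_uminus: "p \<in> mpolys_in V \<Longrightarrow> - p \<in> mpolys_in V"
  for p :: "('v, 'k::ab_group_add) mpoly"
  by (simp add: mpolys_in_def keys_uminus)

lemma mpolys_in_mult: "p \<in> mpolys_in V \<Longrightarrow> q \<in> mpolys_in V \<Longrightarrow> p * q \<in> mpolys_in V"
  for p :: "('v, 'k::comm_semiring_1) mpoly"
  using keys_mult[of p q] by (fastforce simp: mpolys_in_def keys_pp_add)

section \<open>Substitution as a ring homomorphism\<close>

lemma psubst_eq_sum: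
  assumes "h 0 = 0" and "finite A" and "keys p \<subseteq> A"
  shows "psubst h x p = (\<Sum>t\<in>A. h (lookup p t) * (\<Prod>v\<in>keys t. x v ^ lookup t v))"
  unfolding psubst_def
  by (rule sum.mono_neutral_left) (use assms in \<open>auto simp: in_keys_iff\<close>)

lemma prod_power_lookup_add:
  fixes s t :: "'v \<Rightarrow>\<^sub>0 nat" and x :: "'v \<Rightarrow> 'r::comm_semiring_1"
  shows "(\<Prod>v\<in>keys (s + t). x v ^ lookup (s + t) v) =
    (\<Prod>v\<in>keys s. x v ^ lookup s v) * (\<Prod>v\<in>keys t. x v ^ lookup t v)"
proof -
  have *: "(\<Prod>v\<in>keys u. x v ^ lookup u v) = (\<Prod>v\<in>keys s \<union> keys t. x v ^ lookup u v)"
    if "keys u \<subseteq> keys s \<union> keys t" for u :: "'v \<Rightarrow>\<^sub>0 nat"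
    by (rule prod.mono_neutral_left) (use that in \<open>auto simp: in_keys_iff\<close>)
  show ?thesis
    by (simp add: * keys_pp_add lookup_add power_add prod.distrib)
qed

context comm_ring_hom
begin

lemma psubst_single:
  "psubst hom x (single t c) = hom c * (\<Prod>v\<in>keys t. x v ^ lookup t v)"
  by (simp add: psubst_def)

lemma psubst_zero: "psubst hom x 0 = 0"
  by (simp add: psubst_def)

lemma psubst_add: "psubst hom x (p + q) = psubst hom x p + psubst hom x q"
proof -
  have "keys p \<subseteq> keys p \<union> keys q" "keys q \<subseteq> keys p \<union> keys q" "keys (p + q) \<subseteq> keys p \<union> keys q"
    by (auto simp: keys_add)
  then show ?thesis
    by (simp add: psubst_eq_sum[of hom "keys p \<union> keys q"] lookup_add hom_add hom_mult distrib_right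
        sum.distrib)
qed

lemma psubst_mult: "psubst hom x (p * q) = psubst hom x p * psubst hom x q"
proof (induction p rule: poly_mapping_single_induct)
  case (single s a)
  show ?case
  proof (induction q rule: poly_mapping_single_induct)
    case (single t b)
    show ?case
      by (simp add: mult_single psubst_single prod_power_lookup_add hom_add hom_mult ac_simps)
  qed (simp add: psubst_add distrib_left)
qed (simp add: psubst_add distrib_right)

lemma psubst_comm_ring_hom: "comm_ring_hom (psubst hom x)"
  by unfold_locales
    (auto simp: psubst_add psubst_mult psubst_single psubst_zero simp flip: single_one)

lemma psubst_pconst: "psubst hom x (pconst c) = hom c"
  by (simp add: pconst_def psubst_single)

lemma psubst_X: "psubst hom x (X v) = x v"
  by (simp add: X_def pmonom_def psubst_single)

end

subsection \<open>Degrees and the degree reverse lexicographic order\<close>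

lemma pps_add: "s + t \<in> pps n \<longleftrightarrow> s \<in> pps n \<and> t \<in> pps n"
  by (auto simp: pps_def keys_pp_add)

lemma pps_0 [simp]: "0 \<in> pps n"
  by (simp add: pps_def)

lemma pps_single: "single i (Suc 0) \<in> pps n \<longleftrightarrow> i < n"
  by (simp add: pps_def)

lemma pdeg_eq_sum: "finite A \<Longrightarrow> keys t \<subseteq> A \<Longrightarrow> pdeg t = (\<Sum>i\<in>A. lookup t i)"
  unfolding pdeg_def by (rule sum.mono_neutral_left) (auto simp: in_keys_iff)

lemma pdeg_add: "pdeg (s + t) = pdeg s + pdeg t"
  by (simp add: pdeg_eq_sum[of "keys s \<union> keys t"] keys_pp_add lookup_add sum.distrib)

lemma pdeg_0 [simp]: "pdeg 0 = 0"
  by (simp add: pdeg_def)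

lemma pdeg_single [simp]: "pdeg (single i k) = k"
  by (simp add: pdeg_def)

lemma pdeg_eq_0_iff: "pdeg t = 0 \<longleftrightarrow> t = 0"
  by (auto simp: pdeg_def in_keys_iff simp flip: keys_eq_empty)

lemma finite_pps_pdeg_le: "finite {t \<in> pps n. pdeg t \<le> d}"
proof -
  have "lookup t i \<le> d" if "pdeg t \<le> d" for t :: pp and i
    using that member_le_sum[of i "keys t" "lookup t"]
    by (cases "i \<in> keys t") (auto simp: pdeg_def in_keys_iff)
  then have "lookup ` {t \<in> pps n. pdeg t \<le> d} \<subseteq>
      {f. \<forall>i. (i \<in> {..<n} \<longrightarrow> f i \<in> {..d}) \<and> (i \<notin> {..<n} \<longrightarrow> f i = 0)}"
    by (auto simp: pps_def in_keys_iff subset_iff)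
  moreover have "finite {f. \<forall>i. (i \<in> {..<n} \<longrightarrow> f i \<in> {..d}) \<and> (i \<notin> {..<n} \<longrightarrow> f i = (0::nat))}"
    by (rule finite_set_of_finite_funs) auto
  ultimately have "finite (lookup ` {t \<in> pps n. pdeg t \<le> d})"
    by (rule finite_subset)
  then show ?thesis
    by (rule finite_imageD) (auto intro: inj_onI poly_mapping_eqI)
qed

lemma drl_less_irrefl: "\<not> drl_less t t"
  by (simp add: drl_less_def)

lemma drl_less_trans:
  assumes "drl_less s t" and "drl_less t u"
  shows "drl_less s u"
proof (cases "pdeg s = pdeg t \<and> pdeg t = pdeg u")
  case True
  with assms obtain i j where
    "lookup s i > lookup t i" "\<forall>k>i. lookup s k = lookup t k"
    "lookup t j > lookup u j" "\<forall>k>j. lookup t k = lookup u k"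
    by (auto simp: drl_less_def)
  \<comment> \<open>The last index at which \<open>s\<close> and \<open>u\<close> differ is the
    larger of the two witnesses.\<close>
  then have "lookup s (max i j) > lookup u (max i j)"
      "\<forall>k>max i j. lookup s k = lookup u k"
    by (cases i j rule: linorder_cases; simp add: max_def)+
  with True show ?thesis
    by (auto simp: drl_less_def)
next
  case False
  then show ?thesis
    using assms by (auto simp: drl_less_def)
qed

lemma drl_less_total:
  assumes "s \<noteq> t"
  shows "drl_less s t \<or> drl_less t s"
proof -
  let ?D = "{i. lookup s i \<noteq> lookup t i}"
  have "?D \<subseteq> keys s \<union> keys t"
    by (auto simp: in_keys_iff)
  then have fin: "finite ?D"
    by (rule finite_subset) simp
  have "?D \<noteq> {}"
    using assms poly_mapping_eqI[of s t] by blast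
  then have "Max ?D \<in> ?D"
    using Max_in[OF fin] by blast
  moreover have "lookup s j = lookup t j" if "j > Max ?D" for j
    using that Max_ge[OF fin, of j] by (metis (mono_tags) leD mem_Collect_eq)
  ultimately show ?thesis
    unfolding drl_less_def
    by (metis (mono_tags, lifting) linorder_neqE_nat mem_Collect_eq)
qed

lemma drl_less_add_left: "drl_less s t \<Longrightarrow> drl_less (u + s) (u + t)"
  by (auto simp: drl_less_def pdeg_add lookup_add)

text \<open>The feature of DegRevLex on which the proof rests: at the last indeterminate of
  \<open>s\<close>, which comes after \<open>m\<close>, the exponent of \<open>t\<close> is zero,
  and beyond it both exponents vanish. The larger exponent makes \<open>s\<close> the smaller power
  product.\<close>

lemma drl_less_higher_key:
  assumes "pdeg s = pdeg t" and "keys t \<subseteq> {..m}" and "l \<in> keys s" and "m < l"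
  shows "drl_less s t"
proof -
  let ?i = "Max (keys s)"
  have "m < ?i"
    using assms(3,4) Max_ge[of "keys s" l] by (simp add: less_le_trans)
  moreover have "?i \<in> keys s"
    by (rule Max_in) (use assms(3) in auto)
  moreover have "lookup s j = 0" if "j > ?i" for j
    proof -
    have "j \<notin> keys s" using that Max_ge[OF finite_keys[of s], of j] by linarith
    then show ?thesis by (simp add: in_keys_iff)
  qed
  moreover have "lookup t j = 0" if "j > m" for j
    using that assms(2) by (auto simp: in_keys_iff subset_iff leD)
  ultimately show ?thesis
    using assms(1) by (auto simp: drl_less_def in_keys_iff intro!: exI[of _ ?i])
qed

text \<open>A relational form of \<open>lpp_drl\<close> that implies \<open>p\<close> to be nonzero,
  whereas \<open>lpp_drl 0\<close> is an unspecified value.\<close>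

definition leads :: "(nat, 'k::zero) mpoly \<Rightarrow> pp \<Rightarrow> bool" where
  "leads p t \<longleftrightarrow> t \<in> keys p \<and> (\<forall>s\<in>keys p. s \<noteq> t \<longrightarrow> drl_less s t)"

lemma drl_max_exists:
  assumes "finite A" and "A \<noteq> {}"
  shows "\<exists>t\<in>A. \<forall>s\<in>A. s \<noteq> t \<longrightarrow> drl_less s t"
  using assms
proof (induction A rule: finite_ne_induct)
  case (insert x F)
  then obtain t where t: "t \<in> F" "\<forall>s\<in>F. s \<noteq> t \<longrightarrow> drl_less s t"
    by blast
  show ?case
  proof (cases "drl_less x t")
    case True
    with t show ?thesis by auto
  next
    case False
    then have "x = t \<or> drl_less t x" using drl_less_total by blast
    with t show ?thesis using drl_less_trans by (metis insert_iff)
  qed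
qed simp

lemma leads_exists: "p \<noteq> 0 \<Longrightarrow> \<exists>t. leads p t"
  using drl_max_exists[of "keys p"] by (auto simp: leads_def)

lemma lpp_drl_eq:
  assumes "leads p t"
  shows "lpp_drl p = t"
  unfolding lpp_drl_def
proof (rule the_equality)
  show "t \<in> keys p \<and> (\<forall>s\<in>keys p. s \<noteq> t \<longrightarrow> drl_less s t)"
    using assms by (simp add: leads_def)
  show "s = t" if "s \<in> keys p \<and> (\<forall>u\<in>keys p. u \<noteq> s \<longrightarrow> drl_less u s)" for s
    using that assms drl_less_trans drl_less_irrefl unfolding leads_def by metis
qed

lemma leads_lpp_drl: "p \<noteq> 0 \<Longrightarrow> leads p (lpp_drl p)"
  using leads_exists lpp_drl_eq by metis

lemma leads_nonzero: "leads p t \<Longrightarrow> p \<noteq> 0"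
  by (auto simp: leads_def)

text \<open>Among the members with nonzero scalar, only the one with the greatest leading power
  product contributes at that power product, so nothing can cancel it. This supplies the linear
  independence for the dimension count.\<close>

lemma lead_coefficient_combination:
  fixes E :: "'i \<Rightarrow> (nat, 'k::field) mpoly" and a :: "'i \<Rightarrow> 'k"
  assumes "finite Q" and "\<And>q. q \<in> Q \<Longrightarrow> leads (E q) (l q)" and "inj_on l Q"
    and "(\<Sum>q\<in>Q. pconst (a q) * E q) = 0"
  shows "\<forall>q\<in>Q. a q = 0"
proof (rule ccontr)
  let ?A = "{q \<in> Q. a q \<noteq> 0}"
  assume "\<not> (\<forall>q\<in>Q. a q = 0)"
  then have "finite (l ` ?A)" "l ` ?A \<noteq> {}"
    using assms(1) by auto
  from drl_max_exists[OF this] obtain q where q: "q \<in> Q" "a q \<noteq> 0"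
    and max: "\<And>r. r \<in> Q \<Longrightarrow> a r \<noteq> 0 \<Longrightarrow> l r \<noteq> l q \<Longrightarrow> drl_less (l r) (l q)"
    by blast
  have "a r * lookup (E r) (l q) = 0" if "r \<in> Q" "r \<noteq> q" for r
  proof (cases "a r = 0")
    case False
    have "l r \<noteq> l q"
      using that q assms(3) by (auto simp: inj_on_def)
    then have less: "drl_less (l r) (l q)"
      using max that False by blast
    have "l q \<notin> keys (E r)"
      using assms(2)[OF that(1)] less \<open>l r \<noteq> l q\<close> drl_less_trans drl_less_irrefl
      unfolding leads_def by metis
    then show ?thesis by (simp add: in_keys_iff)
  qed simp
  then have "(\<Sum>r\<in>Q - {q}. a r * lookup (E r) (l q)) = 0"
    by (intro sum.neutral) blast
  then have "(\<Sum>r\<in>Q. a r * lookup (E r) (l q)) = a q * lookup (E q) (l q)"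
    by (simp only: sum.remove[OF assms(1) q(1)] add_0_right)
  also have "\<dots> \<noteq> 0"
    using q assms(2)[OF q(1)] by (auto simp: leads_def in_keys_iff)
  finally show False
    using arg_cong[OF assms(4), of "\<lambda>p. lookup p (l q)"]
    by (simp add: lookup_sum lookup_pconst_mult)
qed

subsection \<open>Homogeneous components\<close>

lemma hom_comp_iff:
  "p \<in> hom_comp n d \<longleftrightarrow> (\<forall>t\<in>keys p. t \<in> pps n \<and> pdeg t = d)"
  by (auto simp: hom_comp_def mpolys_in_def pps_def)

lemma hom_comp_mult: "p \<in> hom_comp n d \<Longrightarrow> q \<in> hom_comp n e \<Longrightarrow> p * q \<in> hom_comp n (d + e)"
  for p :: "(nat, 'k::comm_semiring_1) mpoly"
  using keys_mult[of p q] by (fastforce simp: hom_comp_iff pdeg_add pps_add)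

lemma hom_comp_1: "1 \<in> hom_comp n 0"
  by (auto simp: hom_comp_iff)

lemma hom_comp_prod:
  fixes f :: "'i \<Rightarrow> (nat, 'k::comm_semiring_1) mpoly"
  assumes "\<And>i. i \<in> A \<Longrightarrow> f i \<in> hom_comp n (d i)"
  shows "prod f A \<in> hom_comp n (sum d A)"
  using assms
  by (induction A rule: infinite_finite_induct) (auto simp: hom_comp_1 hom_comp_mult)

lemma hom_comp_sum:
  "(\<And>i. i \<in> A \<Longrightarrow> f i \<in> hom_comp n d) \<Longrightarrow> sum f A \<in> hom_comp n d"
  using keys_sum_subset[of f A] by (fastforce simp: hom_comp_iff)

lemma hom_comp_pconst_mult: "p \<in> hom_comp n d \<Longrightarrow> pconst c * p \<in> hom_comp n d"
  for p :: "(nat, 'k::comm_semiring_1) mpoly"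
  using keys_pconst_mult[of c p] by (auto simp: hom_comp_iff)

lemma hom_comp_diff: "p \<in> hom_comp n d \<Longrightarrow> q \<in> hom_comp n d \<Longrightarrow> p - q \<in> hom_comp n d"
  for p :: "(nat, 'k::ab_group_add) mpoly"
  using keys_diff_subset[of p q] by (auto simp: hom_comp_iff)

lemma hom_comp_X: "i < n \<Longrightarrow> X i \<in> hom_comp n 1"
  by (simp add: hom_comp_iff X_def pps_single)

lemma hom_comp_1_eq_sum:
  fixes p :: "(nat, 'k::comm_semiring_1) mpoly"
  assumes "p \<in> hom_comp n 1"
  shows "p = (\<Sum>i<n. pconst (lookup p (single i 1)) * X i)"
proof (rule poly_mapping_eqI)
  fix t :: pp
  have eq: "lookup (\<Sum>i<n. pconst (lookup p (single i 1)) * X i) t =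
      (\<Sum>i<n. if single i 1 = t then lookup p (single i 1) else 0)"
    by (auto simp: lookup_sum lookup_pconst_mult X_def pmonom_def lookup_single when_def
        intro!: sum.cong)
  show "lookup p t = lookup (\<Sum>i<n. pconst (lookup p (single i 1)) * X i) t"
  proof (cases "\<exists>i<n. t = single i 1")
    case True
    then obtain i where "i < n" and t: "t = single i 1" by blast
    then show ?thesis unfolding eq unfolding t single_1_eq_iff by (simp add: sum.delta)
  next
    case False
    have "t \<notin> keys p"
    proof
      assume "t \<in> keys p"
      with assms have t: "t \<in> pps n" "pdeg t = 1" by (auto simp: hom_comp_iff)
      then have "keys t \<noteq> {}" by (auto simp: pdeg_def)
      then obtain i where i: "i \<in> keys t" by blast
      have "t = single i 1 + (t - single i 1)"
        using i by (auto intro!: poly_mapping_eqI simp: lookup_add lookup_minus lookup_single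
            when_def in_keys_iff)
      moreover from this have "pdeg (t - single i 1) = 0"
        using t(2) by (metis pdeg_add pdeg_single add_cancel_left_right)
      ultimately have "t = single i 1" by (simp add: pdeg_eq_0_iff)
      with False t(1) show False using i by (auto simp: pps_single)
    qed
    with False show ?thesis unfolding eq by (auto simp: in_keys_iff intro!: sum.neutral)
  qed
qed

subsection \<open>Distractions\<close>

lemma distraction_single: "distraction n L (single t c) = pconst c * distraction_pp n L t"
  by (simp add: distraction_def pconst_def)

lemma distraction_eq_sum:
  assumes "finite A" and "keys p \<subseteq> A"
  shows "distraction n L p = (\<Sum>t\<in>A. pconst (lookup p t) * distraction_pp n L t)"
  unfolding distraction_def
  by (rule sum.mono_neutral_left) (use assms in \<open>auto simp: in_keys_iff pconst_def\<close>)

lemma distraction_add: "distraction n L (p + q) = distraction n L p + distraction n L q"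
proof -
  have "keys p \<subseteq> keys p \<union> keys q" "keys q \<subseteq> keys p \<union> keys q" "keys (p + q) \<subseteq> keys p \<union> keys q"
    by (auto simp: keys_add)
  then show ?thesis
    by (simp add: distraction_eq_sum[of "keys p \<union> keys q"] lookup_add distrib_right sum.distrib
        pconst_def single_add)
qed

lemma distraction_0 [simp]: "distraction n L 0 = 0"
  by (simp add: distraction_def)

lemma distraction_sum: "distraction n L (sum f A) = (\<Sum>i\<in>A. distraction n L (f i))"
  by (induction A rule: infinite_finite_induct) (auto simp: distraction_add)

lemma distraction_pp_add_single:
  assumes "i < n"
  shows "distraction_pp n L (t + single i 1) = distraction_pp n L t * L i (lookup t i)"
proof -
  have "(\<Prod>k<n. \<Prod>j<lookup (t + single i 1) k. L k j) =
      (\<Prod>k<n. (\<Prod>j<lookup t k. L k j) * (if k = i then L i (lookup t i) else 1))"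
    by (rule prod.cong) (auto simp: lookup_add lookup_single)
  also have "\<dots> = (\<Prod>k<n. \<Prod>j<lookup t k. L k j) * L i (lookup t i)"
    using assms by (simp add: prod.distrib prod.delta)
  finally show ?thesis
    by (simp add: distraction_pp_def)
qed

lemma distraction_pp_hom_comp:
  assumes "\<And>i j. i < n \<Longrightarrow> L i j \<in> hom_comp n 1" and "t \<in> pps n"
  shows "distraction_pp n L t \<in> hom_comp n (pdeg t)"
proof -
  have "(\<Prod>j<lookup t i. L i j) \<in> hom_comp n (\<Sum>j<lookup t i. 1)" if "i < n" for i
    by (rule hom_comp_prod) (use assms that in auto)
  then have "distraction_pp n L t \<in> hom_comp n (\<Sum>i<n. lookup t i)"
    unfolding distraction_pp_def by (intro hom_comp_prod) auto
  also have "(\<Sum>i<n. lookup t i) = pdeg t"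
    using assms(2) by (intro pdeg_eq_sum[symmetric]) (auto simp: pps_def)
  finally show ?thesis .
qed

text \<open>The exchange condition of strong stability alone, in a form that passes directly to the
  colon sets of the induction. The truncated subtraction is exact because \<open>j\<close> occurs in
  \<open>t\<close>.\<close>

definition up_closed :: "pp set \<Rightarrow> bool" where
  "up_closed S \<longleftrightarrow> (\<forall>t\<in>S. \<forall>j\<in>keys t. \<forall>i\<le>j. single i 1 + t - single j 1 \<in> S)"

text \<open>
  Modulo the later indeterminates, every choice of one entry from each of the rows up to \<open>m\<close> spans
  \<open>X m\<close>.
\<close>

definition triangular :: "nat \<Rightarrow> (nat \<Rightarrow> nat \<Rightarrow> (nat, 'k::field) mpoly) \<Rightarrow> bool" where
  "triangular n A \<longleftrightarrow> (\<forall>i<n. \<forall>j. A i j \<in> hom_comp n 1) \<and>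
     (\<forall>m<n. \<forall>js. \<exists>c. \<forall>t\<in>keys (X m - (\<Sum>i\<le>m. pconst (c i) * A i (js i))). \<exists>l>m. l \<in> keys t)"

text \<open>The set \<open>S\<close> is generalised along with \<open>t\<close> because the
  induction hypothesis is applied to the colon of \<open>S\<close> by the last indeterminate of
  \<open>t\<close>. Keeping the keys of \<open>f\<close> in the degree of \<open>t\<close> prepares
  the dimension count in bounded degree.\<close>

lemma distraction_leads_exists:
  assumes "triangular n A" and "t \<in> S" and "S \<subseteq> pps n" and "up_closed S"
  shows "\<exists>f. keys f \<subseteq> {s \<in> S. pdeg s = pdeg t} \<and> leads (distraction n A f) t"
  using assms(2-4)
proof (induction "pdeg t" arbitrary: t S)
  case 0
  then have t: "t = 0" by (simp add: pdeg_eq_0_iff)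
  have "distraction n A 1 = 1"
    using distraction_single[of n A 0 1] by (simp add: distraction_pp_def pconst_def)
  then have "leads (distraction n A 1) t"
    by (simp add: leads_def t)
  then show ?case using 0 t by (intro exI[of _ 1]) auto
next
  case (Suc d)
  define m where "m = Max (keys t)"
  have "keys t \<noteq> {}"
    using Suc(2) by (auto simp: pdeg_def)
  then have m: "m \<in> keys t" "keys t \<subseteq> {..m}"
    by (auto simp: m_def)
  then have mn: "m < n"
    using Suc.prems by (auto simp: pps_def)
  define t' where "t' = t - single m 1"
  have t: "t = t' + single m 1"
    using m by (auto intro!: poly_mapping_eqI simp: t'_def lookup_add lookup_minus lookup_single
        when_def in_keys_iff)
  then have deg: "d = pdeg t'"
    using Suc(2) by (simp add: pdeg_add)
  \<comment> \<open>The colon of \<open>S\<close> by \<open>X m\<close>, to which \<open>t'\<close>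
    belongs.\<close>
  define S' where "S' = {s. s + single m 1 \<in> S}"
  have S'_sub: "S' \<subseteq> pps n"
    using Suc.prems by (auto simp: S'_def pps_add)
  have "up_closed S'"
    unfolding up_closed_def
  proof (intro ballI allI impI)
    fix s j and i :: nat
    assume s: "s \<in> S'" and j: "j \<in> keys s" and "i \<le> j"
    then have "single i 1 + (s + single m 1) - single j 1 \<in> S"
      using Suc.prems(3) by (auto simp: up_closed_def S'_def keys_pp_add)
    also have "single i 1 + (s + single m 1) - single j 1 = single i 1 + s - single j 1 + single m 1"
      using j by (auto intro!: poly_mapping_eqI simp: lookup_add lookup_minus lookup_single
        when_def in_keys_iff)
    finally show "single i 1 + s - single j 1 \<in> S'"
      by (simp add: S'_def)
  qed
  with Suc.hyps(1)[OF deg _ S'_sub] Suc.prems(1) obtain f' where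
    f': "keys f' \<subseteq> {s \<in> S'. pdeg s = d}" "leads (distraction n A f') t'"
    using deg by (auto simp: S'_def t)
  \<comment> \<open>Trading the factor \<open>X m\<close> of \<open>s + single m 1\<close> for
    \<open>X i\<close> is the exchange that puts the terms of \<open>f\<close> into
    \<open>S\<close>.\<close>
  have S'_up: "s + single i 1 \<in> S" if "s \<in> S'" "i \<le> m" for s i
  proof -
    have "single i 1 + (s + single m 1) - single m 1 \<in> S"
      using that Suc.prems(3) by (auto simp: up_closed_def S'_def keys_pp_add)
    also have "single i 1 + (s + single m 1) - single m 1 = s + single i 1"
      by (auto intro!: poly_mapping_eqI simp: lookup_add lookup_minus)
    finally show ?thesis .
  qed
  have lin: "A i j \<in> hom_comp n 1" if "i < n" for i j
    using assms(1) that by (simp add: triangular_def)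
  have "\<forall>s. \<exists>c. \<forall>u\<in>keys (X m - (\<Sum>i\<le>m. pconst (c i) * A i (lookup s i))). \<exists>l>m. l \<in> keys u"
    using assms(1) mn unfolding triangular_def by blast
  from choice[OF this] obtain c where
    c: "\<forall>s. \<forall>u\<in>keys (X m - (\<Sum>i\<le>m. pconst (c s i) * A i (lookup s i))). \<exists>l>m. l \<in> keys u"
    by (elim exE)
  \<comment> \<open>Each product of \<open>X m\<close> and \<open>s\<close> is replaced by the
    combination of the products of \<open>X i\<close> and \<open>s\<close> whose distraction equals
    \<open>X m\<close> times that of \<open>s\<close>, up to the error collected in
    \<open>r\<close>.\<close>
  define f where "f = (\<Sum>s\<in>keys f'. \<Sum>i\<le>m. single (s + single i 1) (lookup f' s * c s i))"
  define r where "r = (\<Sum>s\<in>keys f'. pconst (lookup f' s) * distraction_pp n A s *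
      (X m - (\<Sum>i\<le>m. pconst (c s i) * A i (lookup s i))))"
  have f_keys: "s \<in> S \<and> pdeg s = pdeg t" if sf: "s \<in> keys f" for s
  proof -
    obtain s' where s': "s' \<in> keys f'"
      "s \<in> keys (\<Sum>i\<le>m. single (s' + single i 1) (lookup f' s' * c s' i))"
      using in_keys_sumD[OF sf[unfolded f_def]] by (elim bexE)
    then obtain i where "i \<le> m" "s \<in> keys (single (s' + single i 1) (lookup f' s' * c s' i))"
      using in_keys_sumD[OF s'(2)] by blast
    with s'(1) show ?thesis
      using f'(1) S'_up Suc(2) by (auto simp: pdeg_add split: if_splits)
  qed
  have Df: "distraction n A f = (\<Sum>s\<in>keys f'. pconst (lookup f' s) * distraction_pp n A s *
      (\<Sum>i\<le>m. pconst (c s i) * A i (lookup s i)))"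
    unfolding f_def distraction_sum sum_distrib_left
    using mn distraction_pp_add_single[of _ n A]
    by (intro sum.cong) (auto simp: distraction_single pconst_def mult_single[of 0 _ 0, simplified, symmetric] ac_simps)
  have eq: "distraction n A f = X m * distraction n A f' - r"
    unfolding Df r_def distraction_def[of n A f'] sum_distrib_left
    by (simp add: right_diff_distrib sum_subtractf sum_distrib_left ac_simps)
  have r_keys: "pdeg u = pdeg t \<and> (\<exists>l>m. l \<in> keys u)" if ur: "u \<in> keys r" for u
  proof -
    obtain s where s: "s \<in> keys f'" and u: "u \<in> keys (pconst (lookup f' s) * distraction_pp n A s *
        (X m - (\<Sum>i\<le>m. pconst (c s i) * A i (lookup s i))))"
      using in_keys_sumD[OF ur[unfolded r_def]] by (elim bexE)
    obtain v w where uvw: "u = v + w" and "v \<in> keys (pconst (lookup f' s) * distraction_pp n A s)"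
      and w: "w \<in> keys (X m - (\<Sum>i\<le>m. pconst (c s i) * A i (lookup s i)))"
      using set_mp[OF keys_mult u] by blast
    then have "v \<in> keys (distraction_pp n A s)"
      using keys_pconst_mult by blast
    moreover have "s \<in> pps n" "pdeg s = d"
      using s f'(1) S'_sub by auto
    then have "distraction_pp n A s \<in> hom_comp n d"
      using distraction_pp_hom_comp[of n A s] lin by simp
    ultimately have "pdeg v = d"
      by (auto simp: hom_comp_iff)
    moreover have "pdeg w = 1"
    proof -
      have "X m - (\<Sum>i\<le>m. pconst (c s i) * A i (lookup s i)) \<in> hom_comp n 1"
        using mn by (intro hom_comp_diff hom_comp_X hom_comp_sum hom_comp_pconst_mult lin) auto
      with w show ?thesis
        by (auto simp: hom_comp_iff)
    qed
    ultimately show ?thesis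
      using bspec[OF spec[OF c] w] Suc(2) by (auto simp: uvw pdeg_add keys_pp_add)
  qed
  \<comment> \<open>The error has an indeterminate after \<open>X m\<close> in each of its power
    products, so the coefficient at \<open>t\<close> is the leading coefficient of
    \<open>distraction n A f'\<close>.\<close>
  have "t \<notin> keys r"
    using r_keys m(2) by fastforce
  moreover have "lookup (X m * distraction n A f') t = lookup (distraction n A f') t'"
    unfolding t X_def pmonom_def by (simp add: lookup_single_mult add.commute[of t'])
  ultimately have "t \<in> keys (distraction n A f)"
    using f'(2) by (simp add: eq leads_def in_keys_iff lookup_minus)
  moreover have "drl_less s t" if s: "s \<in> keys (distraction n A f)" "s \<noteq> t" for s
  proof -
    have "s \<in> keys (X m * distraction n A f') \<or> s \<in> keys r"
      using subsetD[OF keys_diff_subset s(1)[unfolded eq]] by simp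
    then show ?thesis
    proof
      assume "s \<in> keys r"
      then show ?thesis
        using r_keys drl_less_higher_key m(2) by metis
    next
      assume "s \<in> keys (X m * distraction n A f')"
      then obtain s' where "s' \<in> keys (distraction n A f')" "s = single m 1 + s'"
        unfolding X_def pmonom_def using keys_single_mult by blast
      then show ?thesis
        using s(2) f'(2) drl_less_add_left[of s' t' "single m 1"]
        by (auto simp: t leads_def add.commute)
    qed
  qed
  ultimately show ?case
    using f_keys by (intro exI[of _ f]) (auto simp: leads_def)
qed

text \<open>Scalars act through constants, as in the span of \<open>distraction_matrix\<close>; this
  gives access to the bound on independent sets.\<close>

interpretation mpoly_vs: vector_space "\<lambda>(c::'k::field) (p::(nat, 'k) mpoly). pconst c * p"
  by unfold_locales (auto simp: algebra_simps pconst_def single_add mult_single simp flip: mult.assoc)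

lemma distraction_in_span:
  assumes "keys f \<subseteq> T"
  shows "distraction n A f \<in> mpoly_vs.span (distraction_pp n A ` T)"
  unfolding distraction_def
  by (intro mpoly_vs.span_sum mpoly_vs.span_scale mpoly_vs.span_base) (use assms in auto)

text \<open>
  By \<open>distraction_leads_exists\<close> the finite-dimensional space spanned by the distractions of
  \<open>{s \<in> S. pdeg s \<le> d}\<close> already has as many leading power products in \<open>S\<close> as its dimension allows.
\<close>

lemma distraction_leads_mem:
  fixes A :: "nat \<Rightarrow> nat \<Rightarrow> (nat, 'k::field) mpoly"
  assumes "triangular n A" and "S \<subseteq> pps n" and "up_closed S"
    and "keys f \<subseteq> S" and "leads (distraction n A f) u"
  shows "u \<in> S"
proof (rule ccontr)
  assume "u \<notin> S"
  obtain d where d: "\<forall>t\<in>keys f. pdeg t \<le> d"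
    by (metis Max_ge finite_imageI finite_keys imageI)
  \<comment> \<open>\<open>f\<close> may be inhomogeneous, so the count takes all degrees up to
    \<open>d\<close> at once.\<close>
  define T where "T = {s \<in> S. pdeg s \<le> d}"
  have fin: "finite T"
    unfolding T_def by (rule finite_subset[OF _ finite_pps_pdeg_le[of n d]]) (use assms(2) in auto)
  \<comment> \<open>For \<open>u\<close> the witness is \<open>f\<close> itself; for
    \<open>q\<close> in \<open>T\<close> it is homogeneous of the degree of \<open>q\<close>, hence
    within the bound \<open>d\<close>.\<close>
  have "\<exists>g. keys g \<subseteq> T \<and> leads (distraction n A g) q" if "q \<in> insert u T" for q
  proof (cases "q = u")
    case True
    then show ?thesis using assms(4,5) d by (auto simp: T_def)
  next
    case False
    then have "q \<in> S" "pdeg q \<le> d" using that by (auto simp: T_def)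
    then show ?thesis
      using distraction_leads_exists[OF assms(1) _ assms(2,3), of q] by (fastforce simp: T_def)
  qed
  then obtain E where E: "\<And>q. q \<in> insert u T \<Longrightarrow> keys (E q) \<subseteq> T"
      "\<And>q. q \<in> insert u T \<Longrightarrow> leads (distraction n A (E q)) q"
    by metis
  let ?P = "\<lambda>q. distraction n A (E q)"
  \<comment> \<open>Distinct leading power products keep the chosen distractions distinct, so none
    is lost when they are counted as a set.\<close>
  have inj: "inj_on ?P (insert u T)"
  proof (rule inj_onI)
    fix q r assume qr: "q \<in> insert u T" "r \<in> insert u T" "?P q = ?P r"
    have "q = lpp_drl (?P q)"
      by (rule lpp_drl_eq[OF E(2), OF qr(1), symmetric])
    also have "\<dots> = lpp_drl (?P r)"
      by (rule arg_cong[OF qr(3)])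
    also have "\<dots> = r"
      by (rule lpp_drl_eq[OF E(2), OF qr(2)])
    finally show "q = r" .
  qed
  have "mpoly_vs.independent (?P ` insert u T)"
  proof
    assume "mpoly_vs.dependent (?P ` insert u T)"
    then obtain a where a: "\<exists>p\<in>?P ` insert u T. a p \<noteq> 0"
        "(\<Sum>p\<in>?P ` insert u T. pconst (a p) * p) = 0"
      using mpoly_vs.dependent_finite[of "?P ` insert u T"] fin by auto
    have "(\<Sum>q\<in>insert u T. pconst (a (?P q)) * ?P q) = 0"
      using a(2) by (simp only: sum.reindex[OF inj] o_def)
    then have "\<forall>q\<in>insert u T. a (?P q) = 0"
      using lead_coefficient_combination[of "insert u T" ?P "\<lambda>q. q" "\<lambda>q. a (?P q)"] fin E(2) by auto
    with a(1) show False by auto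
  qed
  moreover have "?P ` insert u T \<subseteq> mpoly_vs.span (distraction_pp n A ` T)"
    using E(1) distraction_in_span by blast
  \<comment> \<open>As \<open>u\<close> is outside \<open>T\<close>, these are
    \<open>card T + 1\<close> independent vectors in a space spanned by at most
    \<open>card T\<close>.\<close>
  ultimately have "card (?P ` insert u T) \<le> card (distraction_pp n A ` T)"
    using mpoly_vs.independent_span_bound fin by blast
  also have "\<dots> \<le> card T"
    using fin by (rule card_image_le)
  finally have "card (insert u T) \<le> card T"
    by (simp only: card_image[OF inj])
  then show False
    using \<open>u \<notin> S\<close> fin by (simp add: T_def)
qed

subsection \<open>Monomial ideals\<close>

lemma poly_ring_simps [simp]:
  "carrier (poly_ring n) = mpolys_in {..<n}" "monoid.mult (poly_ring n) = (*)"
  "one (poly_ring n) = 1" "zero (poly_ring n) = 0" "add (poly_ring n) = (+)"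
  by (simp_all add: poly_ring_def)

lemma ring_poly_ring: "ring (poly_ring n :: (nat, 'k::comm_ring_1) mpoly ring)"
proof (rule ringI)
  show "abelian_group (poly_ring n :: (nat, 'k) mpoly ring)"
  proof (rule abelian_groupI)
    show "\<exists>y\<in>carrier (poly_ring n). y \<oplus>\<^bsub>poly_ring n\<^esub> x = \<zero>\<^bsub>poly_ring n\<^esub>"
      if "x \<in> carrier (poly_ring n)" for x :: "(nat, 'k) mpoly"
      using that by (intro bexI[of _ "- x"]) (auto simp: mpolys_in_uminus)
  qed (auto simp: mpolys_in_add mpolys_in_0 ac_simps)
  show "Group.monoid (poly_ring n :: (nat, 'k) mpoly ring)"
    by unfold_locales (auto simp: mpolys_in_mult mpolys_in_1 ac_simps)
qed (auto simp: algebra_simps)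

lemma ideal_keys_subset:
  assumes "T \<subseteq> pps n" and "\<And>s u. s \<in> T \<Longrightarrow> u \<in> pps n \<Longrightarrow> u + s \<in> T"
  shows "ideal {p :: (nat, 'k::comm_ring_1) mpoly. keys p \<subseteq> T} (poly_ring n)"
proof (rule idealI[OF ring_poly_ring])
  let ?I = "{p :: (nat, 'k) mpoly. keys p \<subseteq> T}"
  have sub: "?I \<subseteq> mpolys_in {..<n}"
    using assms(1) by (auto simp: mpolys_in_def pps_def)
  have "a_inv (poly_ring n) p = - p" if "p \<in> mpolys_in {..<n}" for p :: "(nat, 'k) mpoly"
  proof -
    interpret ring "poly_ring n :: (nat, 'k) mpoly ring" by (rule ring_poly_ring)
    show ?thesis
      using minus_equality[of "- p" p] that by (simp add: mpolys_in_uminus)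
  qed
  then have "a_inv (poly_ring n) p = - p" if "p \<in> ?I" for p
    using sub that by blast
  then have "a_inv (poly_ring n) p \<in> ?I" if "p \<in> ?I" for p
    using that by (simp add: keys_uminus)
  then show "subgroup ?I (add_monoid (poly_ring n))"
    using sub keys_add by unfold_locales (auto simp: a_inv_def dest!: set_mp[OF keys_add])
  show closed: "x \<otimes>\<^bsub>poly_ring n\<^esub> a \<in> ?I" if "a \<in> ?I" "x \<in> carrier (poly_ring n)" for a x
    using that assms(2) keys_mult[of x a] by (fastforce simp: mpolys_in_def pps_def)
  show "a \<otimes>\<^bsub>poly_ring n\<^esub> x \<in> ?I" if "a \<in> ?I" "x \<in> carrier (poly_ring n)" for a x
    using closed[OF that] by (simp add: mult.commute)
qed

lemma ideal_sum_mem: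
  assumes "ideal I (poly_ring n)" and "\<And>i. i \<in> A \<Longrightarrow> f i \<in> I"
  shows "sum f A \<in> I"
proof -
  interpret ideal I "poly_ring n" by fact
  show ?thesis
    using assms(2)
  proof (induction A rule: infinite_finite_induct)
    case (insert x F)
    then show ?case using additive_subgroup.a_closed[OF additive_subgroup_axioms, of "f x" "sum f F"] by simp
  qed (use additive_subgroup.zero_closed[OF additive_subgroup_axioms] in auto)
qed

text \<open>The polynomials on the right form an ideal containing the generators; conversely, each
  of their terms is a multiple of a generator. Membership thus depends on the keys alone.\<close>

lemma genideal_pmonom:
  assumes "S \<subseteq> pps n"
  shows "genideal (poly_ring n) (pmonom ` S) =
    {p :: (nat, 'k::comm_ring_1) mpoly. keys p \<subseteq> {u + s | u s. u \<in> pps n \<and> s \<in> S}}"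
    (is "?G = {p. keys p \<subseteq> ?T}")
proof
  have sub: "pmonom ` S \<subseteq> carrier (poly_ring n :: (nat, 'k) mpoly ring)"
    using assms by (auto simp: mpolys_in_def pps_def)
  interpret R: ring "poly_ring n :: (nat, 'k) mpoly ring" by (rule ring_poly_ring)
  interpret G: ideal ?G "poly_ring n" by (rule R.genideal_ideal[OF sub])
  have "ideal {p :: (nat, 'k) mpoly. keys p \<subseteq> ?T} (poly_ring n)"
  proof (rule ideal_keys_subset)
    show "?T \<subseteq> pps n"
      using assms by (auto simp: pps_add)
    show "u + s \<in> ?T" if "s \<in> ?T" "u \<in> pps n" for s u
    proof -
      obtain v w where "s = v + w" "v \<in> pps n" "w \<in> S" using \<open>s \<in> ?T\<close> by blast
      moreover from this have "u + s = (u + v) + w" by (simp add: ac_simps)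
      ultimately show ?thesis using that pps_add by blast
    qed
  qed
  moreover have "pmonom ` S \<subseteq> {p :: (nat, 'k) mpoly. keys p \<subseteq> ?T}"
    by (auto intro: exI[of _ 0])
  ultimately show "?G \<subseteq> {p. keys p \<subseteq> ?T}"
    by (rule R.genideal_minimal)
  show "{p. keys p \<subseteq> ?T} \<subseteq> ?G"
  proof
    fix p :: "(nat, 'k) mpoly"
    assume p: "p \<in> {p. keys p \<subseteq> ?T}"
    have "single t (lookup p t) \<in> ?G" if t: "t \<in> keys p" for t
    proof -
      obtain u s where us: "t = u + s" "u \<in> pps n" "s \<in> S"
        using p t by blast
      then have "pmonom s \<in> ?G"
        using R.genideal_self[OF sub] by blast
      moreover have "single u (lookup p t) \<in> mpolys_in {..<n}"
        using us by (auto simp: mpolys_in_def pps_def)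
      ultimately have "single u (lookup p t) * pmonom s \<in> ?G"
        using G.I_l_closed by simp
      then show ?thesis
        by (simp add: pmonom_def mult_single us(1))
    qed
    then have "(\<Sum>t\<in>keys p. single t (lookup p t)) \<in> ?G"
      by (rule ideal_sum_mem[OF G.ideal_axioms])
    then show "p \<in> ?G"
      by (simp flip: poly_mapping_sum_single)
  qed
qed

text \<open>The power products of \<open>I\<close> are closed under multiplication, so they can
  replace any monomial generating set.\<close>

lemma monomial_ideal_eq:
  fixes I :: "(nat, 'k::comm_ring_1) mpoly set"
  assumes "monomial_ideal n I"
  defines "T \<equiv> {t \<in> pps n. pmonom t \<in> I}"
  shows "I = {p. keys p \<subseteq> T}" and "genideal (poly_ring n) (pmonom ` T) = I"
proof -
  obtain S where S: "S \<subseteq> pps n" "I = genideal (poly_ring n) (pmonom ` S)"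
    using assms(1) by (auto simp: monomial_ideal_def)
  let ?U = "{u + s | u s. u \<in> pps n \<and> s \<in> S}"
  have I: "I = {p. keys p \<subseteq> ?U}"
    using S genideal_pmonom by simp
  have "?U \<subseteq> pps n"
    using S(1) by (auto simp: pps_add)
  then have T: "T = ?U"
    unfolding T_def I by auto
  show eq: "I = {p. keys p \<subseteq> T}"
    unfolding T by (rule I)
  have "{u + s | u s. u \<in> pps n \<and> s \<in> T} = T"
  proof
    show "T \<subseteq> {u + s | u s. u \<in> pps n \<and> s \<in> T}"
      by (auto intro: exI[of _ 0])
    show "{u + s | u s. u \<in> pps n \<and> s \<in> T} \<subseteq> T"
      unfolding T
    proof clarify
      fix u v w assume "u \<in> pps n" "v \<in> pps n" "w \<in> S"
      then show "\<exists>u' s. u + (v + w) = u' + s \<and> u' \<in> pps n \<and> s \<in> S"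
        by (intro exI[of _ "u + v"] exI[of _ w]) (auto simp: pps_add ac_simps)
    qed
  qed
  moreover have "T \<subseteq> pps n" by (auto simp: T_def)
  ultimately show "genideal (poly_ring n) (pmonom ` T) = I"
    using genideal_pmonom[of T n] eq by simp
qed

text \<open>By \<open>distraction_leads_exists\<close> and \<open>distraction_leads_mem\<close>, the
  leading power products of the distraction are exactly the power products in \<open>I\<close>, so
  both ideals have the same monomial generators.\<close>

lemma in_drl_distraction:
  fixes A :: "nat \<Rightarrow> nat \<Rightarrow> (nat, 'k::field) mpoly"
  assumes "triangular n A" and "strongly_stable n I"
  shows "in_drl n (distraction n A ` I) = I"
proof -
  define T where "T = {t \<in> pps n. pmonom t \<in> I}"
  have mon: "monomial_ideal n I"
    using assms(2) by (simp add: strongly_stable_def)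
  have I: "I = {p. keys p \<subseteq> T}"
    using monomial_ideal_eq(1)[OF mon] by (simp add: T_def)
  have gen: "genideal (poly_ring n) (pmonom ` T) = I"
    using monomial_ideal_eq(2)[OF mon] by (simp add: T_def)
  have sub: "T \<subseteq> pps n" by (auto simp: T_def)
  have up: "up_closed T"
    unfolding up_closed_def
  proof (intro ballI allI impI)
    fix t j and i :: nat assume t: "t \<in> T" "j \<in> keys t" "i \<le> j"
    let ?s = "single i 1 + t - single j 1"
    have "(pmonom ?s :: (nat, 'k) mpoly) \<in> I"
      using t assms(2) by (auto simp: strongly_stable_def T_def)
    then show "?s \<in> T"
      using I by auto
  qed
  have "{lpp_drl p | p. p \<in> distraction n A ` I \<and> p \<noteq> 0} = T"
  proof
    show "{lpp_drl p | p. p \<in> distraction n A ` I \<and> p \<noteq> 0} \<subseteq> T"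
      using distraction_leads_mem[OF assms(1) sub up] leads_lpp_drl by (auto simp: I)
    show "T \<subseteq> {lpp_drl p | p. p \<in> distraction n A ` I \<and> p \<noteq> 0}"
    proof
      fix t assume "t \<in> T"
      then obtain f where f: "keys f \<subseteq> T" "leads (distraction n A f) t"
        using distraction_leads_exists[OF assms(1) _ sub up] by blast
      then show "t \<in> {lpp_drl p | p. p \<in> distraction n A ` I \<and> p \<noteq> 0}"
        using lpp_drl_eq leads_nonzero by (fastforce simp: I)
    qed
  qed
  then have "{pmonom (lpp_drl p) | p. p \<in> distraction n A ` I \<and> p \<noteq> 0} =
      (pmonom ` T :: (nat, 'k) mpoly set)"
    by blast
  then show ?thesis
    by (simp only: in_drl_def gen)
qed

subsection \<open>Linear changes of coordinates\<close>

lemma gl_act_comm_ring_hom: "comm_ring_hom (gl_act n g)"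
  unfolding gl_act_def by (rule comm_ring_hom.psubst_comm_ring_hom[OF pconst_comm_ring_hom])

lemma gl_act_pconst: "gl_act n g (pconst c) = pconst c"
  unfolding gl_act_def by (rule comm_ring_hom.psubst_pconst[OF pconst_comm_ring_hom])

lemma gl_act_X: "gl_act n g (X j) = (\<Sum>i<n. pconst (g $$ (i, j)) * X i)"
  unfolding gl_act_def by (rule comm_ring_hom.psubst_X[OF pconst_comm_ring_hom])

text \<open>The action is a ring homomorphism fixing constants, so it passes to the single
  entries.\<close>

lemma gl_act_distraction:
  "gl_act n g (distraction n L p) = distraction n (\<lambda>i j. gl_act n g (L i j)) p"
proof -
  interpret comm_ring_hom "gl_act n g" by (rule gl_act_comm_ring_hom)
  show ?thesis
    by (simp add: distraction_def distraction_pp_def hom_sum hom_mult hom_prod gl_act_pconst)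
qed

text \<open>On coefficient vectors of linear forms the action is left multiplication by
  \<open>g\<close>.\<close>

lemma gl_act_linear_form:
  assumes "p \<in> hom_comp n 1"
  shows "gl_act n g p = (\<Sum>i<n. pconst (\<Sum>j<n. g $$ (i, j) * lookup p (single j 1)) * X i)"
proof -
  interpret comm_ring_hom "gl_act n g" by (rule gl_act_comm_ring_hom)
  interpret pconst: comm_ring_hom "pconst :: 'a \<Rightarrow> (nat, 'a) mpoly" by (rule pconst_comm_ring_hom)
  have "gl_act n g p = (\<Sum>j<n. pconst (lookup p (single j 1)) * (\<Sum>i<n. pconst (g $$ (i, j)) * X i))"
    by (subst hom_comp_1_eq_sum[OF assms]) (simp add: hom_sum hom_mult gl_act_pconst gl_act_X)
  also have "\<dots> = (\<Sum>i<n. \<Sum>j<n. pconst (lookup p (single j 1)) * (pconst (g $$ (i, j)) * X i))"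
    unfolding sum_distrib_left by (rule sum.swap)
  also have "\<dots> = (\<Sum>i<n. pconst (\<Sum>j<n. g $$ (i, j) * lookup p (single j 1)) * X i)"
    by (simp add: pconst.hom_sum pconst.hom_mult sum_distrib_right sum_distrib_left ac_simps)
  finally show ?thesis .
qed

lemma lookup_linear_form:
  assumes "i < n"
  shows "lookup (\<Sum>i<n. pconst (c i) * X i :: (nat, 'k::comm_ring_1) mpoly) (single i 1) = c i"
proof -
  have "lookup (\<Sum>j<n. pconst (c j) * X j :: (nat, 'k) mpoly) (single i 1) =
      (\<Sum>j<n. if j = i then c j else 0)"
    unfolding lookup_sum
    by (rule sum.cong) (simp_all add: lookup_pconst_mult lookup_X_single del: One_nat_def)
  with assms show ?thesis by simp
qed

lemma lookup_gl_act_linear_form: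
  assumes "p \<in> hom_comp n 1" and "i < n"
  shows "lookup (gl_act n g p) (single i 1) = (\<Sum>j<n. g $$ (i, j) * lookup p (single j 1))"
  unfolding gl_act_linear_form[OF assms(1)] by (rule lookup_linear_form[OF assms(2)])

lemma gl_act_hom_comp_1: "p \<in> hom_comp n 1 \<Longrightarrow> gl_act n g p \<in> hom_comp n 1"
  unfolding gl_act_linear_form
  by (intro hom_comp_sum hom_comp_pconst_mult hom_comp_X) simp

section \<open>Triangularity from nonvanishing minors\<close>

lemma det_nonzero_right_inverse:
  fixes M :: "'k::field mat"
  assumes "M \<in> carrier_mat k k" and "det M \<noteq> 0"
  obtains B where "B \<in> carrier_mat k k" "M * B = 1\<^sub>m k" "B * M = 1\<^sub>m k"
  using det_non_zero_imp_unit[OF assms] by (auto simp: Units_def ring_mat_def)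

lemma index_mult_mat_sum:
  assumes "A \<in> carrier_mat n k" and "B \<in> carrier_mat k m" and "i < n" and "j < m"
  shows "(A * B) $$ (i, j) = (\<Sum>l<k. A $$ (i, l) * B $$ (l, j))"
  using assms by (simp add: scalar_prod_def atLeast0LessThan)

lemma hom_comp_1_keyE:
  fixes p :: "(nat, 'k::comm_semiring_1) mpoly"
  assumes "p \<in> hom_comp n 1" and "t \<in> keys p"
  obtains l where "l < n" "t = single l 1"
proof -
  have "lookup (\<Sum>i<n. pconst (lookup p (single i 1)) * X i) t \<noteq> 0"
    using hom_comp_1_eq_sum[OF assms(1)] assms(2) by (simp add: in_keys_iff)
  then obtain l where "l < n" "lookup (pconst (lookup p (single l 1)) * X l :: (nat, 'k) mpoly) t \<noteq> 0"
    by (metis (mono_tags, lifting) lookup_sum sum.neutral lessThan_iff)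
  then have "l < n" "t = single l 1"
    by (auto simp: lookup_pconst_mult X_def pmonom_def lookup_single when_def split: if_splits)
  then show thesis by (rule that)
qed

text \<open>Column \<open>i\<close> holds the coefficients of the form chosen from row
  \<open>i\<close>, cut off after \<open>X m\<close>. The size is \<open>Suc m\<close> because
  indices start at zero.\<close>

definition coeff_minor ::
  "(nat \<Rightarrow> nat \<Rightarrow> (nat, 'k::comm_ring_1) mpoly) \<Rightarrow> nat \<Rightarrow> (nat \<Rightarrow> nat) \<Rightarrow> 'k mat" where
  "coeff_minor A m js = mat (Suc m) (Suc m) (\<lambda>(p, i). lookup (A i (js i)) (single p 1))"

text \<open>Modulo the indeterminates after \<open>X m\<close>, the last column of the inverse of
  the minor expresses \<open>X m\<close> through the chosen forms.\<close>

lemma triangularI: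
  fixes A :: "nat \<Rightarrow> nat \<Rightarrow> (nat, 'k::field) mpoly"
  assumes lin: "\<And>i j. i < n \<Longrightarrow> A i j \<in> hom_comp n 1"
    and det: "\<And>m js. m < n \<Longrightarrow> det (coeff_minor A m js) \<noteq> 0"
  shows "triangular n A"
  unfolding triangular_def
proof (intro conjI allI impI lin)
  fix m and js :: "nat \<Rightarrow> nat"
  assume m: "m < n"
  let ?M = "coeff_minor A m js"
  have M: "?M \<in> carrier_mat (Suc m) (Suc m)"
    by (simp add: coeff_minor_def)
  obtain B where B: "B \<in> carrier_mat (Suc m) (Suc m)" "?M * B = 1\<^sub>m (Suc m)"
    using det_nonzero_right_inverse[OF M det[OF m]] by blast
  let ?p = "X m - (\<Sum>i\<le>m. pconst (B $$ (i, m)) * A i (js i))"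
  have "(\<Sum>i\<le>m. pconst (B $$ (i, m)) * A i (js i)) \<in> hom_comp n 1"
    by (intro hom_comp_sum hom_comp_pconst_mult lin) (use m in auto)
  then have p: "?p \<in> hom_comp n 1"
    by (rule hom_comp_diff[OF hom_comp_X[OF m]])
  have zero: "lookup ?p (single l 1) = 0" if l: "l \<le> m" for l
  proof -
    have "(\<Sum>i\<le>m. B $$ (i, m) * lookup (A i (js i)) (single l 1)) =
        (\<Sum>i<Suc m. ?M $$ (l, i) * B $$ (i, m))"
      unfolding lessThan_Suc_atMost
      by (rule sum.cong) (use l in \<open>simp_all add: coeff_minor_def mult.commute\<close>)
    also have "\<dots> = (?M * B) $$ (l, m)"
      using l by (intro index_mult_mat_sum[OF M B(1), symmetric]) simp_all
    also have "\<dots> = (if l = m then 1 else 0)"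
      using l by (simp add: B(2))
    finally have "(\<Sum>i\<le>m. B $$ (i, m) * lookup (A i (js i)) (single l 1)) = (if l = m then 1 else 0)" .
    moreover have "lookup (X m :: (nat, 'k) mpoly) (single l 1) = (if l = m then 1 else 0)"
      by (simp add: lookup_X_single eq_commute del: One_nat_def)
    ultimately show ?thesis
      by (simp add: lookup_minus lookup_sum lookup_pconst_mult)
  qed
  show "\<exists>c. \<forall>t\<in>keys (X m - (\<Sum>i\<le>m. pconst (c i) * A i (js i))). \<exists>l>m. l \<in> keys t"
  proof (intro exI[of _ "\<lambda>i. B $$ (i, m)"] ballI)
    fix t assume t: "t \<in> keys ?p"
    obtain l where l: "t = single l 1"
      using hom_comp_1_keyE[OF p t] by blast
    with zero[of l] t have "l > m"
      by (meson in_keys_iff not_le)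
    with l show "\<exists>l>m. l \<in> keys t" by auto
  qed
qed

subsection \<open>Polynomial functions on matrices\<close>

text \<open>One polynomial represents \<phi> on matrices of every dimension, so the closure
  properties carry no side condition on \<open>g\<close>.\<close>

definition poly_fun :: "nat \<Rightarrow> ('k::field mat \<Rightarrow> 'k) \<Rightarrow> bool" where
  "poly_fun n \<phi> \<longleftrightarrow>
     (\<exists>f\<in>mpolys_in ({..<n} \<times> {..<n}). \<forall>g. \<phi> g = psubst (\<lambda>c. c) (\<lambda>ij. g $$ ij) f)"

lemma comm_ring_hom_ident: "comm_ring_hom (\<lambda>c :: 'k::comm_ring_1. c)"
  by unfold_locales auto

lemma poly_fun_const: "poly_fun n (\<lambda>g. c)"
  unfolding poly_fun_def
  by (intro bexI[of _ "pconst c"]) (auto simp: comm_ring_hom.psubst_pconst[OF comm_ring_hom_ident] mpolys_in_pconst)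

lemma poly_fun_entry: "i < n \<Longrightarrow> j < n \<Longrightarrow> poly_fun n (\<lambda>g. g $$ (i, j))"
  unfolding poly_fun_def
  by (intro bexI[of _ "X (i, j)"]) (auto simp: comm_ring_hom.psubst_X[OF comm_ring_hom_ident] mpolys_in_X)

lemma poly_fun_add: "poly_fun n \<phi> \<Longrightarrow> poly_fun n \<psi> \<Longrightarrow> poly_fun n (\<lambda>g. \<phi> g + \<psi> g)"
  by (auto simp: poly_fun_def comm_ring_hom.psubst_add[OF comm_ring_hom_ident] intro!: bexI[OF _ mpolys_in_add])

lemma poly_fun_mult: "poly_fun n \<phi> \<Longrightarrow> poly_fun n \<psi> \<Longrightarrow> poly_fun n (\<lambda>g. \<phi> g * \<psi> g)"
  by (auto simp: poly_fun_def comm_ring_hom.psubst_mult[OF comm_ring_hom_ident] intro!: bexI[OF _ mpolys_in_mult])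

lemma poly_fun_sum: "(\<And>i. i \<in> A \<Longrightarrow> poly_fun n (\<phi> i)) \<Longrightarrow> poly_fun n (\<lambda>g. \<Sum>i\<in>A. \<phi> i g)"
proof (induction A rule: infinite_finite_induct)
  case (insert x F)
  have "poly_fun n (\<lambda>g. \<phi> x g + (\<Sum>i\<in>F. \<phi> i g))"
    by (rule poly_fun_add[OF insert.prems insert.IH[OF insert.prems]]) simp_all
  then show ?case
    using insert.hyps by simp
qed (simp_all add: poly_fun_const)

lemma poly_fun_prod: "(\<And>i. i \<in> A \<Longrightarrow> poly_fun n (\<phi> i)) \<Longrightarrow> poly_fun n (\<lambda>g. \<Prod>i\<in>A. \<phi> i g)"
proof (induction A rule: infinite_finite_induct)
  case (insert x F)
  have "poly_fun n (\<lambda>g. \<phi> x g * (\<Prod>i\<in>F. \<phi> i g))"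
    by (rule poly_fun_mult[OF insert.prems insert.IH[OF insert.prems]]) simp_all
  then show ?case
    using insert.hyps by simp
qed (simp_all add: poly_fun_const)

text \<open>The Leibniz expansion is a sum of signed products of entries.\<close>

lemma poly_fun_det:
  assumes "\<And>g. M g \<in> carrier_mat k k"
    and "\<And>i j. i < k \<Longrightarrow> j < k \<Longrightarrow> poly_fun n (\<lambda>g. M g $$ (i, j))"
  shows "poly_fun n (\<lambda>g. det (M g))"
proof -
  have "poly_fun n (\<lambda>g. \<Sum>p\<in>{p. p permutes {0..<k}}. signof p * (\<Prod>i=0..<k. M g $$ (i, p i)))"
  proof (intro poly_fun_sum poly_fun_mult poly_fun_const poly_fun_prod assms(2))
    fix p i assume "p \<in> {p. p permutes {0..<k}}" "i \<in> {0..<k}"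
    then show "i < k" "p i < k"
      using permutes_in_image[of p "{0..<k}" i] by auto
  qed
  then show ?thesis
    by (simp only: det_def'[OF assms(1)])
qed

lemma poly_fun_line:
  assumes "poly_fun n \<phi>"
  shows "\<exists>q. \<forall>s. poly q s = \<phi> (mat n n (\<lambda>ij. a $$ ij + s * (b $$ ij - a $$ ij)))"
proof -
  obtain f where f: "f \<in> mpolys_in ({..<n} \<times> {..<n})"
      "\<And>g. \<phi> g = psubst (\<lambda>c. c) (\<lambda>ij. g $$ ij) f"
    using assms by (auto simp: poly_fun_def)
  \<comment> \<open>Each indeterminate is replaced by the affine polynomial with value
    \<open>a $$ ij\<close> at 0 and \<open>b $$ ij\<close> at 1.\<close>
  define q where "q = psubst (\<lambda>c. [:c:]) (\<lambda>ij. [:a $$ ij, b $$ ij - a $$ ij:]) f"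
  have "poly q s = \<phi> (mat n n (\<lambda>ij. a $$ ij + s * (b $$ ij - a $$ ij)))" for s
    unfolding q_def f(2) psubst_def poly_sum poly_mult poly_prod poly_power
  proof (intro sum.cong prod.cong arg_cong2[of _ _ _ _ "(*)"] arg_cong2[of _ _ _ _ "(^)"] refl)
    fix t v assume "t \<in> keys f" "v \<in> keys t"
    then have "v \<in> {..<n} \<times> {..<n}"
      using f(1) by (auto simp: mpolys_in_def)
    then show "poly [:a $$ v, b $$ v - a $$ v:] s =
        mat n n (\<lambda>ij. a $$ ij + s * (b $$ ij - a $$ ij)) $$ v"
      by (auto simp: algebra_simps)
  qed simp
  then show ?thesis by (intro exI allI)
qed

text \<open>
  Two polynomial functions restrict to univariate polynomials on the line through points at which
  they do not vanish.
\<close>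

lemma poly_fun_common_nonzero:
  fixes \<phi> \<psi> :: "'k::field mat \<Rightarrow> 'k"
  assumes "infinite (UNIV :: 'k set)" and "poly_fun n \<phi>" and "poly_fun n \<psi>"
    and a: "a \<in> carrier_mat n n" "\<phi> a \<noteq> 0" and b: "b \<in> carrier_mat n n" "\<psi> b \<noteq> 0"
  shows "\<exists>g\<in>carrier_mat n n. \<phi> g * \<psi> g \<noteq> 0"
proof -
  let ?l = "\<lambda>s. mat n n (\<lambda>ij. a $$ ij + s * (b $$ ij - a $$ ij))"
  obtain q where q: "\<forall>s. poly q s = \<phi> (?l s)"
    using poly_fun_line[OF assms(2), of a b] by (elim exE)
  obtain r where r: "\<forall>s. poly r s = \<psi> (?l s)"
    using poly_fun_line[OF assms(3), of a b] by (elim exE)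
  have "?l 0 = a" "?l 1 = b"
    using a b by (auto intro!: eq_matI)
  then have "poly q 0 \<noteq> 0" "poly r 1 \<noteq> 0"
    using a b q r by auto
  \<comment> \<open>Univariate polynomials over a field form a domain, and a nonzero one has too few
    roots to exhaust an infinite field.\<close>
  then have "q * r \<noteq> 0" by auto
  then have "finite {s. poly (q * r) s = 0}"
    by (rule poly_roots_finite)
  then obtain s where "poly (q * r) s \<noteq> 0"
    using assms(1) by (metis (mono_tags, lifting) UNIV_I finite_subset mem_Collect_eq subsetI)
  then show ?thesis
    using q r by (intro bexI[of _ "?l s"]) auto
qed

text \<open>Each factor may have its own nonvanishing point; the line argument merges these points
  one factor at a time.\<close>

lemma poly_fun_prod_nonzero:
  fixes \<phi> :: "'i \<Rightarrow> 'k::field mat \<Rightarrow> 'k"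
  assumes "infinite (UNIV :: 'k set)" and "finite A"
    and "\<And>i. i \<in> A \<Longrightarrow> poly_fun n (\<phi> i)" and "\<And>i. i \<in> A \<Longrightarrow> \<exists>g\<in>carrier_mat n n. \<phi> i g \<noteq> 0"
  shows "\<exists>g\<in>carrier_mat n n. (\<Prod>i\<in>A. \<phi> i g) \<noteq> 0"
  using assms(2-4)
proof (induction A rule: finite_induct)
  case empty
  show ?case by (intro bexI[of _ "0\<^sub>m n n"]) auto
next
  case (insert x F)
  obtain a b where "a \<in> carrier_mat n n" "\<phi> x a \<noteq> 0" "b \<in> carrier_mat n n" "(\<Prod>i\<in>F. \<phi> i b) \<noteq> 0"
    using insert by (metis insertCI)
  moreover have "poly_fun n (\<lambda>g. \<Prod>i\<in>F. \<phi> i g)"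
    by (rule poly_fun_prod) (use insert in auto)
  ultimately have "\<exists>g\<in>carrier_mat n n. \<phi> x g * (\<Prod>i\<in>F. \<phi> i g) \<noteq> 0"
    using poly_fun_common_nonzero[OF assms(1)] insert.prems(1) by blast
  then show ?case using insert by simp
qed

section \<open>Invertible matrices and generic changes of coordinates\<close>

lemma det_nonzero_GL:
  assumes "g \<in> carrier_mat n n" and "det g \<noteq> 0"
  shows "g \<in> GL n"
proof -
  obtain B where "B \<in> carrier_mat n n" "g * B = 1\<^sub>m n" "B * g = 1\<^sub>m n"
    using det_nonzero_right_inverse[OF assms] by blast
  then show ?thesis
    using assms(1) by (auto simp: GL_def invertible_mat_def inverts_mat_def)
qed

lemma GL_det_nonzero: "g \<in> GL n \<Longrightarrow> det g \<noteq> 0"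
  for g :: "'k::field mat"
proof -
  assume "g \<in> GL n"
  then obtain B where g: "g \<in> carrier_mat n n" and B: "g * B = 1\<^sub>m n" "B * g = 1\<^sub>m (dim_row B)"
    by (auto simp: GL_def invertible_mat_def inverts_mat_def)
  have "dim_col B = n" "dim_row B = n"
    using g arg_cong[OF B(1), of dim_col] arg_cong[OF B(2), of dim_col] by auto
  then have "B \<in> carrier_mat n n" by auto
  then show ?thesis
    using det_mult[OF g] B(1) by (metis det_one mult_zero_left zero_neq_one)
qed

text \<open>The span is taken of a set, which does not record the rows. The combinations indexed by
  rows form a subspace containing that set, hence they contain its span.\<close>

lemma distraction_matrix_span:
  assumes "distraction_matrix n L" and "p \<in> hom_comp n 1"
  shows "\<exists>b. p = (\<Sum>i<n. pconst (b i) * L i (js i))"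
proof -
  let ?W = "{p. \<exists>b. p = (\<Sum>i<n. pconst (b i) * L i (js i))}"
  interpret comm_ring_hom "pconst :: 'a \<Rightarrow> (nat, 'a) mpoly" by (rule pconst_comm_ring_hom)
  have "mpoly_vs.span {L i (js i) | i. i < n} \<subseteq> ?W"
  proof (rule mpoly_vs.span_minimal)
    show "{L i (js i) | i. i < n} \<subseteq> ?W"
    proof clarify
      fix i assume "i < n"
      then have "L i (js i) = (\<Sum>k<n. pconst (if k = i then 1 else 0) * L k (js k))"
        by (simp add: if_distrib[of pconst] if_distrib[of "\<lambda>x. x * _"] sum.delta cong: if_cong)
      then show "\<exists>b. L i (js i) = (\<Sum>i<n. pconst (b i) * L i (js i))"
        by (intro exI[of _ "\<lambda>k. if k = i then 1 else 0"])
    qed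
    show "mpoly_vs.subspace ?W"
    proof (rule mpoly_vs.subspaceI)
      show "0 \<in> ?W" by (auto intro: exI[of _ "\<lambda>i. 0"])
      show "x + y \<in> ?W" if xy: "x \<in> ?W" "y \<in> ?W" for x y
      proof -
        obtain b c where "x = (\<Sum>i<n. pconst (b i) * L i (js i))" "y = (\<Sum>i<n. pconst (c i) * L i (js i))"
          using xy by blast
        then have "x + y = (\<Sum>i<n. pconst (b i + c i) * L i (js i))"
          by (simp add: hom_add distrib_right sum.distrib)
        then show ?thesis by (intro CollectI exI[of _ "\<lambda>i. b i + c i"])
      qed
      show "pconst c * x \<in> ?W" if x: "x \<in> ?W" for c x
      proof -
        obtain b where b: "x = (\<Sum>i<n. pconst (b i) * L i (js i))"
          using x by blast
        have "pconst c * x = (\<Sum>i<n. pconst (c * b i) * L i (js i))"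
          by (simp only: b hom_mult sum_distrib_left mult.assoc)
        then show ?thesis by (intro CollectI exI[of _ "\<lambda>i. c * b i"])
      qed
    qed
  qed
  moreover have "mpoly_vs.span {L i (js i) | i. i < n} = hom_comp n 1"
    using assms(1) unfolding distraction_matrix_def by blast
  ultimately show ?thesis
    using assms(2) by blast
qed

text \<open>
  The witness is the inverse of the coefficient matrix of the forms \<open>L i (js i)\<close>, which maps
  \<open>L i (js i)\<close> to \<open>X i\<close>.
\<close>

lemma coeff_minor_nonzero_exists:
  fixes L :: "nat \<Rightarrow> nat \<Rightarrow> (nat, 'k::field) mpoly"
  assumes "distraction_matrix n L" and "m < n"
  shows "\<exists>g\<in>carrier_mat n n. det (coeff_minor (\<lambda>i j. gl_act n g (L i j)) m js) \<noteq> 0"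
proof -
  have lin: "L i (js i) \<in> hom_comp n 1" if "i < n" for i
    using assms(1) that by (auto simp: distraction_matrix_def)
  have "\<forall>j. \<exists>b. j < n \<longrightarrow> X j = (\<Sum>i<n. pconst (b i) * L i (js i))"
    using distraction_matrix_span[OF assms(1)] hom_comp_X by blast
  then obtain b where b: "\<And>j. j < n \<Longrightarrow> X j = (\<Sum>i<n. pconst (b j i) * L i (js i))"
    by metis
  define C where "C = mat n n (\<lambda>(p, i). lookup (L i (js i)) (single p 1))"
  define g where "g = mat n n (\<lambda>(i, j). b j i)"
  have carrier: "C \<in> carrier_mat n n" "g \<in> carrier_mat n n"
    by (auto simp: C_def g_def)
  \<comment> \<open>Column \<open>j\<close> of \<open>g\<close> holds the coordinates of
    \<open>X j\<close> in the chosen forms, so this compares the coefficients of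
    \<open>X p\<close>.\<close>
  have "C * g = 1\<^sub>m n"
  proof (rule eq_matI)
    fix p j assume "p < dim_row (1\<^sub>m n :: 'k mat)" "j < dim_col (1\<^sub>m n :: 'k mat)"
    then have pj: "p < n" "j < n" by auto
    have "(C * g) $$ (p, j) = (\<Sum>i<n. b j i * lookup (L i (js i)) (single p 1))"
      unfolding index_mult_mat_sum[OF carrier pj]
      by (rule sum.cong) (use pj in \<open>simp_all add: C_def g_def\<close>)
    also have "\<dots> = lookup (X j :: (nat, 'k) mpoly) (single p 1)"
      by (simp add: b[OF pj(2)] lookup_sum lookup_pconst_mult)
    also have "\<dots> = 1\<^sub>m n $$ (p, j)"
      using pj by (simp add: lookup_X_single del: One_nat_def)
    finally show "(C * g) $$ (p, j) = 1\<^sub>m n $$ (p, j)" .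
  qed (use carrier in auto)
  then have gC: "g * C = 1\<^sub>m n"
    using mat_mult_left_right_inverse carrier by blast
  \<comment> \<open>The columns of \<open>g * C\<close> are the coefficients of the images of the
    chosen forms, and a leading block of the identity is again an identity.\<close>
  have "coeff_minor (\<lambda>i j. gl_act n g (L i j)) m js = 1\<^sub>m (Suc m)"
  proof (rule eq_matI)
    fix p i assume "p < dim_row (1\<^sub>m (Suc m) :: 'k mat)" "i < dim_col (1\<^sub>m (Suc m) :: 'k mat)"
    then have pi: "p < Suc m" "i < Suc m" "p < n" "i < n"
      using assms(2) by auto
    have "lookup (gl_act n g (L i (js i))) (single p 1) = (g * C) $$ (p, i)"
      unfolding lookup_gl_act_linear_form[OF lin[OF pi(4)] pi(3)]
        index_mult_mat_sum[OF carrier(2,1) pi(3,4)]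
      by (rule sum.cong) (use pi in \<open>simp_all add: C_def\<close>)
    with pi show "coeff_minor (\<lambda>i j. gl_act n g (L i j)) m js $$ (p, i) = 1\<^sub>m (Suc m) $$ (p, i)"
      by (simp add: coeff_minor_def gC)
  qed (auto simp: coeff_minor_def)
  then show ?thesis
    using carrier(2) by (intro bexI[of _ g]) auto
qed

lemma poly_fun_coeff_minor:
  fixes L :: "nat \<Rightarrow> nat \<Rightarrow> (nat, 'k::field) mpoly"
  assumes "\<And>i j. i < n \<Longrightarrow> L i j \<in> hom_comp n 1" and "m < n"
  shows "poly_fun n (\<lambda>g. det (coeff_minor (\<lambda>i j. gl_act n g (L i j)) m js))"
proof (rule poly_fun_det)
  fix p i assume "p < Suc m" "i < Suc m"
  then have pi: "p < n" "i < n" "p < Suc m" "i < Suc m"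
    using assms(2) by auto
  have "poly_fun n (\<lambda>g. \<Sum>j<n. g $$ (p, j) * lookup (L i (js i)) (single j 1))"
    by (intro poly_fun_sum poly_fun_mult poly_fun_entry poly_fun_const) (use pi in auto)
  then show "poly_fun n (\<lambda>g. coeff_minor (\<lambda>i j. gl_act n g (L i j)) m js $$ (p, i))"
    using pi lookup_gl_act_linear_form[OF assms(1)] by (simp add: coeff_minor_def)
qed (auto simp: coeff_minor_def)

text \<open>Rows are constant from column \<open>N\<close> on, so only finitely many minors occur,
  and \<phi> is their product.\<close>

lemma generically_triangular:
  fixes L :: "nat \<Rightarrow> nat \<Rightarrow> (nat, 'k::field) mpoly"
  assumes "infinite (UNIV :: 'k set)" and L: "distraction_matrix n L"
  obtains \<phi> where "poly_fun n \<phi>" "\<exists>g\<in>carrier_mat n n. \<phi> g \<noteq> 0"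
    "\<And>g. \<phi> g \<noteq> 0 \<Longrightarrow> triangular n (\<lambda>i j. gl_act n g (L i j))"
proof -
  have lin: "L i j \<in> hom_comp n 1" if "i < n" for i j
    using L that by (simp add: distraction_matrix_def)
  obtain N where N: "\<And>i j. i < n \<Longrightarrow> j > N \<Longrightarrow> L i j = L i N"
    using L unfolding distraction_matrix_def by blast
  \<comment> \<open>The function space fixes the value outside \<open>{..<n}\<close>, which makes
    the set of column choices finite.\<close>
  define Q where "Q = {..<n} \<times> ({..<n} \<rightarrow>\<^sub>E {..N})"
  define \<psi> where "\<psi> = (\<lambda>(m, js) g. det (coeff_minor (\<lambda>i j. gl_act n g (L i j)) m js))"
  have fin: "finite Q"
    by (auto simp: Q_def intro!: finite_PiE)
  have pf: "poly_fun n (\<psi> q)" if "q \<in> Q" for q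
    using that poly_fun_coeff_minor[OF lin] by (auto simp: \<psi>_def Q_def)
  have nz: "\<exists>g\<in>carrier_mat n n. \<psi> q g \<noteq> 0" if "q \<in> Q" for q
    using that coeff_minor_nonzero_exists[OF L] by (auto simp: \<psi>_def Q_def)
  have "triangular n (\<lambda>i j. gl_act n g (L i j))" if g: "(\<Prod>q\<in>Q. \<psi> q g) \<noteq> 0" for g
  proof (rule triangularI)
    fix m and js :: "nat \<Rightarrow> nat"
    assume m: "m < n"
    \<comment> \<open>Columns beyond \<open>N\<close> are replaced by \<open>N\<close>, which leaves
      the chosen entries unchanged.\<close>
    define ks where "ks = (\<lambda>i\<in>{..<n}. min (js i) N)"
    have "L i (js i) = L i (ks i)" if "i < n" for i
      using N[OF that, of "js i"] that by (auto simp: ks_def min_def)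
    then have "coeff_minor (\<lambda>i j. gl_act n g (L i j)) m js =
        coeff_minor (\<lambda>i j. gl_act n g (L i j)) m ks"
      using m by (auto simp: coeff_minor_def intro!: eq_matI)
    moreover have "(m, ks) \<in> Q"
      using m by (auto simp: Q_def ks_def)
    then have "\<psi> (m, ks) g \<noteq> 0"
      using g fin by simp
    ultimately show "det (coeff_minor (\<lambda>i j. gl_act n g (L i j)) m js) \<noteq> 0"
      by (simp add: \<psi>_def)
  qed (rule gl_act_hom_comp_1[OF lin])
  moreover have "poly_fun n (\<lambda>g. \<Prod>q\<in>Q. \<psi> q g)"
    using pf by (rule poly_fun_prod)
  moreover have "\<exists>g\<in>carrier_mat n n. (\<Prod>q\<in>Q. \<psi> q g) \<noteq> 0"
    using assms(1) fin pf nz by (rule poly_fun_prod_nonzero)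
  ultimately show thesis
    using that by blast
qed

text \<open>A point of \<open>U\<close> is invertible and some defining \<open>f\<close> is nonzero
  there. So \<phi>, \<open>f\<close> and the determinant are each nonzero somewhere, hence all at
  one common matrix.\<close>

lemma poly_fun_nonzero_meets_open:
  fixes U :: "'k::field mat set"
  assumes "infinite (UNIV :: 'k set)" and "poly_fun n \<phi>" and "\<exists>g\<in>carrier_mat n n. \<phi> g \<noteq> 0"
    and "zariski_open_GL n U" and "U \<noteq> {}"
  shows "\<exists>g\<in>U. \<phi> g \<noteq> 0"
proof -
  obtain F where F: "F \<subseteq> mpolys_in ({..<n} \<times> {..<n})"
      "U = {g \<in> GL n. \<exists>f\<in>F. psubst (\<lambda>c. c) (\<lambda>ij. g $$ ij) f \<noteq> 0}"
    using assms(4) unfolding zariski_open_GL_def by blast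
  define ev :: "(nat \<times> nat, 'k) mpoly \<Rightarrow> 'k mat \<Rightarrow> 'k"
    where "ev = (\<lambda>f g. psubst (\<lambda>c. c) (\<lambda>ij. g $$ ij) f)"
  obtain h f where h: "h \<in> GL n" "f \<in> F" "ev f h \<noteq> 0"
    using assms(5) F(2) by (auto simp: ev_def)
  have ev: "poly_fun n (ev f)"
    using h(2) F(1) by (auto simp: poly_fun_def ev_def)
  \<comment> \<open>\<open>det g\<close> depends on the dimension of \<open>g\<close>, so it is a polynomial function only on \<open>carrier_mat n n\<close>\<close>
  have det: "poly_fun n (\<lambda>g :: 'k mat. det (mat n n (\<lambda>(i, j). g $$ (i, j))))"
    by (rule poly_fun_det[where k = n]) (auto simp: poly_fun_entry)
  have det_eq: "det (mat n n (\<lambda>(i, j). g $$ (i, j))) = det g" if "g \<in> carrier_mat n n" for g :: "'k mat"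
    using that by (intro arg_cong[of _ _ det] eq_matI) auto
  have hc: "h \<in> carrier_mat n n" using h(1) by (simp add: GL_def)
  then obtain a where a: "a \<in> carrier_mat n n" "\<phi> a * ev f a \<noteq> 0"
    using poly_fun_common_nonzero[OF assms(1,2) ev] assms(3) h(3) by blast
  obtain g where g: "g \<in> carrier_mat n n"
      "\<phi> g * ev f g * det (mat n n (\<lambda>(i, j). g $$ (i, j))) \<noteq> 0"
    using poly_fun_common_nonzero[OF assms(1) poly_fun_mult[OF assms(2) ev] det a hc]
      GL_det_nonzero[OF h(1)] det_eq[OF hc] by auto
  then have "g \<in> U"
    using det_nonzero_GL[of g n] det_eq[of g] h(2) by (auto simp: F(2) ev_def)
  with g show ?thesis by auto
qed

section \<open>The generic initial ideal of a distraction\<close>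

theorem theorem4p3:
  fixes n :: nat
    and I :: "(nat, 'k::field) mpoly set"
    and L :: "nat \<Rightarrow> nat \<Rightarrow> (nat, 'k) mpoly"
  assumes "infinite (UNIV :: 'k set)"
    and "strongly_stable n I"
    and "distraction_matrix n L"
  shows "gin_drl n (distraction n L ` I) = I"
proof -
  obtain \<phi> where \<phi>: "poly_fun n \<phi>" "\<exists>g\<in>carrier_mat n n. \<phi> g \<noteq> 0"
    and tri: "\<And>g. \<phi> g \<noteq> 0 \<Longrightarrow> triangular n (\<lambda>i j. gl_act n g (L i j))"
    using generically_triangular[OF assms(1,3)] by metis
  have in_eq: "in_drl n (gl_act n g ` distraction n L ` I) = I" if "\<phi> g \<noteq> 0" for g
    using in_drl_distraction[OF tri[OF that] assms(2)]
    by (simp add: image_image gl_act_distraction)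
  obtain f where f: "f \<in> mpolys_in ({..<n} \<times> {..<n})" "\<And>g. \<phi> g = psubst (\<lambda>c. c) (\<lambda>ij. g $$ ij) f"
    using \<phi>(1) by (auto simp: poly_fun_def)
  let ?U = "{g \<in> GL n. \<phi> g \<noteq> 0}"
  have "zariski_open_GL n ?U"
    unfolding zariski_open_GL_def using f by (intro exI[of _ "{f}"]) auto
  moreover have "?U \<noteq> {}"
  proof -
    have one: "(1\<^sub>m n :: 'k mat) \<in> GL n"
      by (rule det_nonzero_GL) auto
    \<comment> \<open>The whole group is open, given by the constant 1, so it meets the nonvanishing
      locus of \<phi>.\<close>
    have "zariski_open_GL n (GL n :: 'k mat set)"
      unfolding zariski_open_GL_def
      by (intro exI[of _ "{1}"]) (auto simp: mpolys_in_1 psubst_def)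
    then show ?thesis
      using poly_fun_nonzero_meets_open[OF assms(1) \<phi>] one by blast
  qed
  ultimately have "\<exists>U. zariski_open_GL n U \<and> U \<noteq> {} \<and>
      (\<forall>g\<in>U. in_drl n (gl_act n g ` distraction n L ` I) = I)"
    using in_eq by blast
  moreover have "monomial_ideal n I"
    using assms(2) by (simp add: strongly_stable_def)
  \<comment> \<open>Uniqueness for the definite description: every nonempty open set contains some
    \<open>g\<close> with \<open>\<phi> g \<noteq> 0\<close>, where the initial ideal is known to be
    \<open>I\<close>.\<close>
  moreover have "M = I" if "zariski_open_GL n U" "U \<noteq> {}"
      "\<forall>g\<in>U. in_drl n (gl_act n g ` distraction n L ` I) = M" for M and U :: "'k mat set"
    using poly_fun_nonzero_meets_open[OF assms(1) \<phi> that(1,2)] in_eq that(3) by auto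
  ultimately show ?thesis
    unfolding gin_drl_def by (intro the_equality) blast+
qed

end
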